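(* Let $k$ be a field of characteristic $p>0$, let $m\ge 1$ and let $(\ell,r_1,r_2)\in\Omega_m$. Let $A(T),B(T)\in({}^{\ell}\mathfrak{H}^{r_1}_{r_2})^E$, and write $A(T)=\hslash(x)$ with $x=(S,\boldsymbol{a}_1,\boldsymbol{a}_2,\boldsymbol{\alpha}_2,\alpha)\in{}^{\ell}\mathbb{X}^{r_1}_{r_2}$ and $B(T)=\hslash(x')$ with $x'=(S',\boldsymbol{b}_1,\boldsymbol{b}_2,\boldsymbol{\beta}_2,\beta)\in{}^{\ell}\mathbb{X}^{r_1}_{r_2}$. Then the following conditions are equivalent: (1) $A(T)$ and $B(T)$ are equivalent, i.e. there exists $P\in GL(m+2,k)$ with $P^{-1}A(T)P=B(T)$. (2) $x'=x\star g$ for some $g\in{}^{\ell}G^{r_1}_{r_2}$.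
   Context: $k[T]$ is the polynomial ring in one variable. $A(T)\in\mathrm{Mat}(n,k[T])$ is exponential if $A(0)=I_n$ and $A(T)A(T')=A(T+T')$ ($T,T'$ indeterminates). For a set $S$ of polynomial matrices, $S^E$ is the set of exponential matrices in $S$. $\mathfrak{P}$ is the set of $p$-polynomials, i.e. polynomials $\sum_{i\ge0}c_iT^{p^i}$ with $c_i\in k$. $\Omega_m:=\{(\ell,r_1,r_2)\in\mathbb{Z}^3\mid 1\le \ell\le m,\ 1\le r_1\le \ell,\ 0\le r_2\le m-\ell\}$. For row vectors $\boldsymbol{a}_1\in k[T]^{r_1}$, $\boldsymbol{a}_2\in k[T]^{\ell-r_1}$, $\boldsymbol{\alpha}_1\in k[T]^{r_1}$, $\boldsymbol{\alpha}_2\in k[T]^{r_2}$ and $\varphi\in k[T]$, let $$h(\boldsymbol{a}_1,\boldsymbol{a}_2,\boldsymbol{\alpha}_1,\boldsymbol{\alpha}_2,\varphi)=\begin{pmatrix}1&\boldsymbol{a}_1&\boldsymbol{a}_2&\boldsymbol{0}&\boldsymbol{0}&\varphi\\ \boldsymbol 0&I_{r_1}&O&O&O&{}^t\boldsymbol{\alpha}_1\\ \boldsymbol 0&O&I_{\ell-r_1}&O&O&\boldsymbol{0}\\ \boldsymbol 0&O&O&I_{r_2}&O&{}^t\boldsymbol{\alpha}_2\\ \boldsymbol 0&O&O&O&I_{m-\ell-r_2}&\boldsymbol{0}\\ 0&\boldsymbol 0&\boldsymbol 0&\boldsymbol 0&\boldsymbol 0&1\end{pmatrix}\in\mathrm{Mat}(m+2,k[T]).$$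 ${}^{\ell}\mathfrak{H}^{r_1}_{r_2}$ is the set of all such matrices for which the $\ell$ entries of $(\boldsymbol{a}_1,\boldsymbol{a}_2)$ are linearly independent over $k$ and the $r_1+r_2$ entries of $(\boldsymbol{\alpha}_1,\boldsymbol{\alpha}_2)$ are linearly independent over $k$. $GL\mathrm{ss}(n,k)$: the set of symmetric matrices in $GL(n,k)$ if $p\ge3$; the set of symmetric matrices in $GL(n,k)$ with all diagonal entries zero if $p=2$. ${}^{\ell}\mathbb{X}^{r_1}_{r_2}$ is the set of tuples $(S,\boldsymbol{a}_1,\boldsymbol{a}_2,\boldsymbol{\alpha}_2,\alpha)$ with $S\in GL\mathrm{ss}(r_1,k)$, $\boldsymbol{a}_1\in\mathfrak{P}^{r_1}$, $\boldsymbol{a}_2\in\mathfrak{P}^{\ell-r_1}$, $\boldsymbol{\alpha}_2\in\mathfrak{P}^{r_2}$, $\alpha\in\mathfrak{P}$, such that the entries of $(\boldsymbol{a}_1,\boldsymbol{a}_2)$ are linearly independent over $k$ and the entries of $(\boldsymbol{a}_1,\boldsymbol{\alpha}_2)$ are linearly independent over $k$. $\hslash(S,\boldsymbol{a}_1,\boldsymbol{a}_2,\boldsymbol{\alpha}_2,\alpha):=h(\boldsymbol{a}_1,\boldsymbol{a}_2,\boldsymbol{a}_1S,\boldsymbol{\alpha}_2,\varphi)$, where, with $\boldsymbol{a}_1=(a_1,\dots,a_{r_1})$ and $S=(s_{i,j})$, $\varphi=\alpha+\sum_{1\le i<j\le r_1}s_{i,j}a_ia_j$ if $p=2$ and $\varphi=\alpha+\frac12\boldsymbol{a}_1S\,{}^t\boldsymbol{a}_1$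 if $p\ge3$. The map $\hslash$ is a bijection from ${}^{\ell}\mathbb{X}^{r_1}_{r_2}$ onto $({}^{\ell}\mathfrak{H}^{r_1}_{r_2})^E$. ${}^{\ell}G^{r_1}_{r_2}$ is the group of all regular matrices $$g=\begin{pmatrix}g_{1,1}&O&O&O&O\\O&g_{2,2}&g_{2,3}&g_{2,4}&g_{2,5}\\O&O&g_{3,3}&O&g_{3,5}\\O&O&O&g_{4,4}&g_{4,5}\\O&O&O&O&g_{5,5}\end{pmatrix}\in GL(\ell+r_1+r_2+1,k)$$ with diagonal blocks of sizes $r_1,r_1,\ell-r_1,r_2,1$ and with $g_{1,1}\cdot{}^tg_{2,2}=g_{5,5}I_{r_1}$. For $\Sigma=(\sigma_{i,j})\in\mathrm{Mat}(n,k)$, $\Sigma_+$ is its strictly upper triangular part (entries $\sigma_{i,j}$ for $i<j$, and $0$ otherwise). For $\boldsymbol{a}\in k[T]^n$, $Q,\Sigma\in\mathrm{Mat}(n,k)$: $\Delta_{\boldsymbol{a},Q,\Sigma_+}:=\mathrm{Tr}(\mathrm{diag}(\boldsymbol{a})\,Q\,\Sigma_+\,{}^tQ\,\mathrm{diag}(\boldsymbol{a}))$ if $p=2$, and $:=0$ if $p\ge3$. $(S,\boldsymbol{a}_1,\boldsymbol{a}_2,\boldsymbol{\alpha}_2,\alpha)\star g:=(S',\boldsymbol{b}_1,\boldsymbol{b}_2,\boldsymbol{\beta}_2,\beta)$, where $S'=g_{2,2}^{-1}Sg_{1,1}$, $\boldsymbol{b}_1=\boldsymbol{a}_1g_{2,2}$,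 $\boldsymbol{b}_2=\boldsymbol{a}_1g_{2,3}+\boldsymbol{a}_2g_{3,3}$, $\boldsymbol{\beta}_2=\boldsymbol{a}_1g_{2,4}+\boldsymbol{\alpha}_2g_{4,4}$, $\beta=\boldsymbol{a}_1g_{2,5}+\boldsymbol{a}_2g_{3,5}+\boldsymbol{\alpha}_2g_{4,5}+\alpha g_{5,5}-\Delta_{\boldsymbol{a}_1,\,g_{2,2},\,S'_+}$. *)

theory Defs
  imports "Jordan_Normal_Form.Determinant"
begin

text \<open>Vectors and matrices are those of \<open>Jordan_Normal_Form\<close>, indexed from \<open>0\<close>; the ring \<open>k[T]\<close> is
  \<open>'a poly\<close>, and the characteristic of \<open>k\<close> is \<open>CHAR('a)\<close>. A vector is written as a row vector.\<close>

subsection \<open>Matrices over \<open>k\<close> and over \<open>k[T]\<close>\<close>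

definition GL :: "nat \<Rightarrow> 'a::field mat set" where
  "GL n = Units (ring_mat TYPE('a) n ())"

definition mat_inv :: "nat \<Rightarrow> 'a::field mat \<Rightarrow> 'a mat" where
  "mat_inv n P = m_inv (ring_mat TYPE('a) n ()) P"

definition const_mat :: "'a::zero mat \<Rightarrow> 'a poly mat" where
  "const_mat M = map_mat (\<lambda>c. [:c:]) M"

text \<open>The product of a row vector over \<open>k[T]\<close> and a matrix over \<open>k\<close>.\<close>

definition row_times :: "'a::comm_ring_1 poly vec \<Rightarrow> 'a mat \<Rightarrow> 'a poly vec" where
  "row_times a M = transpose_mat (const_mat M) *\<^sub>v a"

definition mat_trace :: "'a::comm_monoid_add mat \<Rightarrow> 'a" where
  "mat_trace M = sum_list (diag_mat M)"

definition equivalent_mats :: "nat \<Rightarrow> 'a::field poly mat \<Rightarrow> 'a poly mat \<Rightarrow> bool" where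
  "equivalent_mats n A B \<longleftrightarrow> (\<exists>P\<in>GL n. const_mat (mat_inv n P) * A * const_mat P = B)"

text \<open>Linear independence over \<open>k\<close> of the entries as a family (a repeated entry is a dependence).\<close>

definition lin_indep_entries :: "'a::field poly vec \<Rightarrow> bool" where
  "lin_indep_entries v \<longleftrightarrow>
     (\<forall>c :: nat \<Rightarrow> 'a. (\<Sum>i<dim_vec v. Polynomial.smult (c i) (v $ i)) = 0 \<longrightarrow> (\<forall>i<dim_vec v. c i = 0))"

subsection \<open>Exponential matrices and \<open>p\<close>-polynomials\<close>

text \<open>The ring \<open>k[T, T']\<close> is \<open>'a poly poly\<close>, with inner variable \<open>T\<close> and outer variable \<open>T'\<close>;
  \<open>subst_var X q\<close> is \<open>q(X)\<close>.\<close>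

definition subst_var :: "'a::comm_ring_1 poly poly \<Rightarrow> 'a poly \<Rightarrow> 'a poly poly" where
  "subst_var X q = poly (map_poly (\<lambda>c. [:[:c:]:]) q) X"

definition var_T :: "'a::comm_ring_1 poly poly" where
  "var_T = [:[:0, 1:]:]"

definition var_T' :: "'a::comm_ring_1 poly poly" where
  "var_T' = [:0, 1:]"

definition exponential :: "nat \<Rightarrow> 'a::comm_ring_1 poly mat \<Rightarrow> bool" where
  "exponential n A \<longleftrightarrow> A \<in> carrier_mat n n \<and>
     map_mat (\<lambda>q. poly q 0) A = 1\<^sub>m n \<and>
     map_mat (subst_var var_T) A * map_mat (subst_var var_T') A = map_mat (subst_var (var_T + var_T')) A"

definition exponential_part :: "nat \<Rightarrow> 'a::comm_ring_1 poly mat set \<Rightarrow> 'a poly mat set" where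
  "exponential_part n \<S> = {A \<in> \<S>. exponential n A}"

definition p_polys :: "'a::comm_ring_1 poly set" where
  "p_polys = {q. \<exists>(c :: nat \<Rightarrow> 'a) N. q = (\<Sum>i<N. monom (c i) (CHAR('a) ^ i))}"

definition p_poly_vecs :: "nat \<Rightarrow> 'a::comm_ring_1 poly vec set" where
  "p_poly_vecs r = {a \<in> carrier_vec r. \<forall>i<r. a $ i \<in> p_polys}"

subsection \<open>The matrices \<open>h\<close> and the sets \<open>\<HH>\<close>\<close>

definition Omega :: "nat \<Rightarrow> (nat \<times> nat \<times> nat) set" where
  "Omega m = {(l, r1, r2). 1 \<le> l \<and> l \<le> m \<and> 1 \<le> r1 \<and> r1 \<le> l \<and> r2 \<le> m - l}"

text \<open>The block matrix is the identity except in its first row and its last column; both are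
  listed below block by block and both contain the corner entry \<open>\<phi>\<close>.\<close>

definition h_mat :: "nat \<Rightarrow> nat \<Rightarrow> nat \<Rightarrow> nat \<Rightarrow> 'a::comm_ring_1 poly vec \<Rightarrow> 'a poly vec \<Rightarrow>
    'a poly vec \<Rightarrow> 'a poly vec \<Rightarrow> 'a poly \<Rightarrow> 'a poly mat" where
  "h_mat m l r1 r2 a1 a2 \<alpha>1 \<alpha>2 \<phi> =
    (let first_row = vec_of_list [1] @\<^sub>v a1 @\<^sub>v a2 @\<^sub>v 0\<^sub>v r2 @\<^sub>v 0\<^sub>v (m - l - r2) @\<^sub>v vec_of_list [\<phi>];
         last_col = vec_of_list [\<phi>] @\<^sub>v \<alpha>1 @\<^sub>v 0\<^sub>v (l - r1) @\<^sub>v \<alpha>2 @\<^sub>v 0\<^sub>v (m - l - r2) @\<^sub>v vec_of_list [1]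
     in mat (m + 2) (m + 2) (\<lambda>(i, j).
          if i = 0 then first_row $ j
          else if j = m + 1 then last_col $ i
          else if i = j then 1 else 0))"

definition frakH :: "nat \<Rightarrow> nat \<Rightarrow> nat \<Rightarrow> nat \<Rightarrow> 'a::field poly mat set" where
  "frakH m l r1 r2 = {h_mat m l r1 r2 a1 a2 \<alpha>1 \<alpha>2 \<phi> | a1 a2 \<alpha>1 \<alpha>2 \<phi>.
     a1 \<in> carrier_vec r1 \<and> a2 \<in> carrier_vec (l - r1) \<and>
     \<alpha>1 \<in> carrier_vec r1 \<and> \<alpha>2 \<in> carrier_vec r2 \<and>
     lin_indep_entries (a1 @\<^sub>v a2) \<and> lin_indep_entries (\<alpha>1 @\<^sub>v \<alpha>2)}"

subsection \<open>The parametrization of the exponential matrices of \<open>\<HH>\<close>\<close>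

definition GLss :: "nat \<Rightarrow> 'a::field mat set" where
  "GLss n = {S \<in> GL n. transpose_mat S = S \<and> (CHAR('a) = 2 \<longrightarrow> (\<forall>i<n. S $$ (i, i) = 0))}"

type_synonym 'a datum = "'a mat \<times> 'a poly vec \<times> 'a poly vec \<times> 'a poly vec \<times> 'a poly"

definition frakX :: "nat \<Rightarrow> nat \<Rightarrow> nat \<Rightarrow> 'a::field datum set" where
  "frakX l r1 r2 = {(S, a1, a2, \<alpha>2, \<alpha>).
     S \<in> GLss r1 \<and> a1 \<in> p_poly_vecs r1 \<and> a2 \<in> p_poly_vecs (l - r1) \<and>
     \<alpha>2 \<in> p_poly_vecs r2 \<and> \<alpha> \<in> p_polys \<and>
     lin_indep_entries (a1 @\<^sub>v a2) \<and> lin_indep_entries (a1 @\<^sub>v \<alpha>2)}"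

fun hslash :: "nat \<Rightarrow> nat \<Rightarrow> nat \<Rightarrow> nat \<Rightarrow> 'a::field datum \<Rightarrow> 'a poly mat" where
  "hslash m l r1 r2 (S, a1, a2, \<alpha>2, \<alpha>) =
    h_mat m l r1 r2 a1 a2 (row_times a1 S) \<alpha>2
      (if CHAR('a) = 2
       then \<alpha> + (\<Sum>j<r1. \<Sum>i<j. Polynomial.smult (S $$ (i, j)) (a1 $ i * a1 $ j))
       else \<alpha> + Polynomial.smult (1 / 2) (row_times a1 S \<bullet> a1))"

subsection \<open>The group \<open>G\<close> and its action\<close>

text \<open>\<open>mat_block ns M i j\<close> is the block in block row \<open>i\<close> and block column \<open>j\<close> (counted from \<open>1\<close>)
  of a matrix \<open>M\<close> whose rows and columns are both partitioned by the list of sizes \<open>ns\<close>.\<close>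

definition mat_block :: "nat list \<Rightarrow> 'a mat \<Rightarrow> nat \<Rightarrow> nat \<Rightarrow> 'a mat" where
  "mat_block ns M i j = mat (ns ! (i - 1)) (ns ! (j - 1))
     (\<lambda>(u, v). M $$ (sum_list (take (i - 1) ns) + u, sum_list (take (j - 1) ns) + v))"

definition G_sizes :: "nat \<Rightarrow> nat \<Rightarrow> nat \<Rightarrow> nat list" where
  "G_sizes l r1 r2 = [r1, r1, l - r1, r2, 1]"

definition G_group :: "nat \<Rightarrow> nat \<Rightarrow> nat \<Rightarrow> 'a::field mat set" where
  "G_group l r1 r2 = {g \<in> GL (l + r1 + r2 + 1).
     (let ns = G_sizes l r1 r2; blk = mat_block ns g in
       (\<forall>i\<in>{1..5}. \<forall>j\<in>{1..5}.
          i \<noteq> j \<and> (i, j) \<notin> {(2, 3), (2, 4), (2, 5), (3, 5), (4, 5)} \<longrightarrow>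
          blk i j = 0\<^sub>m (ns ! (i - 1)) (ns ! (j - 1))) \<and>
       blk 1 1 * transpose_mat (blk 2 2) = blk 5 5 $$ (0, 0) \<cdot>\<^sub>m 1\<^sub>m r1)}"

definition strict_upper :: "'a::zero mat \<Rightarrow> 'a mat" where
  "strict_upper M = mat (dim_row M) (dim_col M) (\<lambda>(i, j). if i < j then M $$ (i, j) else 0)"

text \<open>\<open>Delta a Q U\<close> is applied to \<open>U = strict_upper \<Sigma>\<close>.\<close>

definition Delta :: "'a::field poly vec \<Rightarrow> 'a mat \<Rightarrow> 'a mat \<Rightarrow> 'a poly" where
  "Delta a Q U =
    (if CHAR('a) = 2
     then let D = mat_diag (dim_vec a) (\<lambda>i. a $ i)
          in mat_trace (D * const_mat Q * const_mat U * transpose_mat (const_mat Q) * D)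
     else 0)"

text \<open>A row vector times a block with one column is a vector of dimension \<open>1\<close>, read off by \<open>$ 0\<close>.\<close>

fun star :: "nat \<Rightarrow> nat \<Rightarrow> nat \<Rightarrow> 'a::field datum \<Rightarrow> 'a mat \<Rightarrow> 'a datum" where
  "star l r1 r2 (S, a1, a2, \<alpha>2, \<alpha>) g =
    (let blk = mat_block (G_sizes l r1 r2) g;
         S' = mat_inv r1 (blk 2 2) * S * blk 1 1;
         b1 = row_times a1 (blk 2 2);
         b2 = row_times a1 (blk 2 3) + row_times a2 (blk 3 3);
         \<beta>2 = row_times a1 (blk 2 4) + row_times \<alpha>2 (blk 4 4);
         \<beta> = row_times a1 (blk 2 5) $ 0 + row_times a2 (blk 3 5) $ 0 + row_times \<alpha>2 (blk 4 5) $ 0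
             + Polynomial.smult (blk 5 5 $$ (0, 0)) \<alpha> - Delta a1 (blk 2 2) (strict_upper S')
     in (S', b1, b2, \<beta>2, \<beta>))"

end

theory Submission
  imports Defs
begin

text \<open>Write \<open>A = I + N\<close> with \<open>N\<close> supported on the first row \<open>u\<close>, the last column \<open>w\<close> and the corner
  \<open>\<phi>\<close>. Linear independence of the entries of \<open>u\<close> and of \<open>w\<close> forces every \<open>P\<close> with \<open>A P = P B\<close> to be
  block upper triangular for the sizes \<open>1, m, 1\<close>, and after scaling \<open>P\<close> the relation says \<open>u Q = u'\<close>,
  \<open>w = c\<^sup>-\<^sup>1 Q w'\<close> and a relation between \<open>\<phi>\<close> and \<open>\<phi>'\<close>, where \<open>Q\<close> is the middle block. Independence again
  annihilates blocks of \<open>Q\<close>, and makes its diagonal blocks invertible. The blocks of \<open>Q\<close> in the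
  \<open>u\<close>-rows give \<open>g\<^sub>2\<^sub>2\<close>, \<open>g\<^sub>2\<^sub>3\<close>, \<open>g\<^sub>3\<^sub>3\<close>; those in the \<open>\<alpha>\<^sub>2\<close>-rows give, after inversion, \<open>g\<^sub>2\<^sub>4\<close> and
  \<open>g\<^sub>4\<^sub>4\<close>; \<open>c\<close> is \<open>g\<^sub>5\<^sub>5\<close>; and comparing \<open>w\<close> in the first block yields \<open>g\<^sub>2\<^sub>2 S' g\<^sub>2\<^sub>2\<^sup>T = c S\<close>, which turns
  the quadratic part of \<open>\<phi>\<close> into that of \<open>\<phi>'\<close> up to \<open>\<Delta>\<close>. The last column of \<open>g\<close> absorbs the
  remaining linear terms.\<close>

subsection \<open>Rows of polynomials and constant matrices\<close>

lemma semiring_hom_const_poly: "semiring_hom (\<lambda>c :: 'a::comm_ring_1. [:c:])"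
  by unfold_locales simp_all

lemma const_mat_carrier [simp]: "const_mat M \<in> carrier_mat n k \<longleftrightarrow> M \<in> carrier_mat n k"
  and dim_const_mat [simp]: "dim_row (const_mat M) = dim_row M" "dim_col (const_mat M) = dim_col M"
  and index_const_mat [simp]:
    "i < dim_row M \<Longrightarrow> j < dim_col M \<Longrightarrow> const_mat M $$ (i, j) = [:M $$ (i, j):]"
  by (simp_all add: const_mat_def)

lemma const_mat_mult:
  "M \<in> carrier_mat n k \<Longrightarrow> N \<in> carrier_mat k q \<Longrightarrow>
    const_mat (M * N) = const_mat M * const_mat (N :: 'a::comm_ring_1 mat)"
  unfolding const_mat_def by (rule semiring_hom.mat_hom_mult[OF semiring_hom_const_poly])

lemma const_mat_one [simp]: "const_mat (1\<^sub>m n :: 'a::comm_ring_1 mat) = 1\<^sub>m n"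
  unfolding const_mat_def by (rule semiring_hom.mat_hom_one[OF semiring_hom_const_poly])

lemma const_mat_transpose: "const_mat (transpose_mat M) = transpose_mat (const_mat M)"
  by (rule eq_matI) (simp_all add: const_mat_def)

lemma index_row_times:
  "M \<in> carrier_mat n k \<Longrightarrow> a \<in> carrier_vec n \<Longrightarrow> j < k \<Longrightarrow>
    row_times a M $ j = (\<Sum>i<n. smult (M $$ (i, j)) (a $ i))"
  by (auto simp: row_times_def scalar_prod_def lessThan_atLeast0 intro!: sum.cong)

lemma dim_row_times [simp]: "dim_vec (row_times a M) = dim_col M"
  by (simp add: row_times_def)

lemma row_times_carrier [simp]:
  "M \<in> carrier_mat n k \<Longrightarrow> row_times a M \<in> carrier_vec k"
  by (simp add: row_times_def carrier_vecI)

lemma row_times_mult: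
  assumes "M \<in> carrier_mat n k" "N \<in> carrier_mat k q" "a \<in> carrier_vec n"
  shows "row_times (row_times a M) N = row_times a (M * N)"
  unfolding row_times_def
  using assms by (simp add: const_mat_mult[OF assms(1,2)]
    transpose_mult[of _ n k _ q] assoc_mult_mat_vec[of _ q k _ n])

lemma row_times_one [simp]: "a \<in> carrier_vec n \<Longrightarrow> row_times a (1\<^sub>m n) = a"
  by (simp add: row_times_def)

lemma row_times_uminus:
  "M \<in> carrier_mat n k \<Longrightarrow> a \<in> carrier_vec n \<Longrightarrow> row_times a (- M) = - row_times a M"
  by (intro eq_vecI) (auto simp: index_row_times[where n = n and k = k] sum_negf)

lemma row_times_minus:
  "M \<in> carrier_mat n k \<Longrightarrow> N \<in> carrier_mat n k \<Longrightarrow> a \<in> carrier_vec n \<Longrightarrow>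
    row_times a (M - N) = row_times a M - row_times a N"
  by (intro eq_vecI)
    (auto simp: index_row_times[where n = n and k = k] smult_diff_left sum_subtractf
      minus_carrier_mat)

lemma row_times_add_vec:
  "M \<in> carrier_mat n k \<Longrightarrow> a \<in> carrier_vec n \<Longrightarrow> b \<in> carrier_vec n \<Longrightarrow>
    row_times (a + b) M = row_times a M + row_times b M"
  by (intro eq_vecI) (auto simp: index_row_times[where n = n and k = k] smult_add_right sum.distrib)

lemma row_times_zero [simp]: "a \<in> carrier_vec n \<Longrightarrow> row_times a (0\<^sub>m n k) = 0\<^sub>v k"
  by (intro eq_vecI) (auto simp: index_row_times[where n = n and k = k])

lemma zero_row_times [simp]: "M \<in> carrier_mat n k \<Longrightarrow> row_times (0\<^sub>v n) M = 0\<^sub>v k"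
  by (intro eq_vecI) (auto simp: index_row_times[where n = n and k = k])

lemma smult_sum_right: "smult c (\<Sum>i\<in>I. f i) = (\<Sum>i\<in>I. smult c (f i))"
  by (induction I rule: infinite_finite_induct) (auto simp: smult_add_right)

section \<open>Linear independence of the entries of a row\<close>

lemma sum_lessThan_add:
  fixes f :: "nat \<Rightarrow> 'b::comm_monoid_add"
  shows "(\<Sum>i<n + k. f i) = (\<Sum>i<n. f i) + (\<Sum>i<k. f (n + i))"
  by (induction k) (auto simp: ac_simps)

text \<open>A column of \<open>M\<close> stacked on the same column of \<open>N\<close> is the
  coefficient family of a relation between the entries of \<open>a\<close> and \<open>b\<close>, so
  it is zero. Applied to equations between rows, this annihilates blocks of constant
  matrices.\<close>

lemma lin_indep_appendD:
  assumes ind: "lin_indep_entries (a @\<^sub>v b)" and a: "a \<in> carrier_vec n" and b: "b \<in> carrier_vec k"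
    and M: "M \<in> carrier_mat n q" and N: "N \<in> carrier_mat k q"
    and eq: "row_times a M + row_times b N = 0\<^sub>v q"
  shows "M = 0\<^sub>m n q" "N = 0\<^sub>m k q"
proof -
  have *: "(\<forall>i<n. M $$ (i, j) = 0) \<and> (\<forall>i<k. N $$ (i, j) = 0)" if j: "j < q" for j
  proof -
    define c where "c i = (if i < n then M $$ (i, j) else N $$ (i - n, j))" for i
    have "(\<Sum>i<dim_vec (a @\<^sub>v b). smult (c i) ((a @\<^sub>v b) $ i)) =
        (\<Sum>i<n. smult (M $$ (i, j)) (a $ i)) + (\<Sum>i<k. smult (N $$ (i, j)) (b $ i))"
      using a b by (simp add: sum_lessThan_add c_def)
    also have "\<dots> = (row_times a M + row_times b N) $ j"
      using a b M N j by (simp add: index_row_times[where n = n and k = q]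
          index_row_times[where n = k and k = q])
    also have "\<dots> = 0" using j by (simp add: eq)
    finally have c: "\<forall>i<n + k. c i = 0"
      using ind a b unfolding lin_indep_entries_def by auto
    have "M $$ (i, j) = 0" if "i < n" for i
      using c[rule_format, of i] that by (simp add: c_def)
    moreover have "N $$ (i, j) = 0" if "i < k" for i
      using c[rule_format, of "n + i"] that by (simp add: c_def)
    ultimately show ?thesis by blast
  qed
  show "M = 0\<^sub>m n q" "N = 0\<^sub>m k q"
    using * M N by (auto intro!: eq_matI)
qed

lemma lin_indep_append_left:
  assumes "lin_indep_entries (a @\<^sub>v b)" "a \<in> carrier_vec n" "b \<in> carrier_vec k"
    and "M \<in> carrier_mat n q" and "row_times a M = 0\<^sub>v q"
  shows "M = 0\<^sub>m n q"
  by (rule lin_indep_appendD(1)[OF assms(1-4), of "0\<^sub>m k q"]) (use assms in auto)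

lemma lin_indep_append_cancel:
  assumes "lin_indep_entries (a @\<^sub>v b)" "a \<in> carrier_vec n" "b \<in> carrier_vec k"
    and M: "M \<in> carrier_mat n q" and N: "N \<in> carrier_mat n q" and eq: "row_times a M = row_times a N"
  shows "M = N"
proof -
  have "row_times a (M - N) = 0\<^sub>v q"
    using assms by (simp add: row_times_minus[OF M N])
  hence "M - N = 0\<^sub>m n q"
    using lin_indep_append_left[OF assms(1-3) minus_carrier_mat[OF N]] by blast
  thus ?thesis
    by (intro eq_matI) (use M N in \<open>auto dest!: arg_cong[of _ _ "\<lambda>X. X $$ _"] simp: mat_eq_iff\<close>)
qed

section \<open>Invertible matrices over the field\<close>

lemma GL_carrier: "X \<in> GL n \<Longrightarrow> X \<in> carrier_mat n n"
  by (simp add: GL_def Units_def ring_mat_simps)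

lemma GL_iff_det: "X \<in> GL n \<longleftrightarrow> X \<in> carrier_mat n n \<and> det X \<noteq> 0"
  using unit_imp_det_non_zero[of X n "()"] det_non_zero_imp_unit[of X n "()"] GL_carrier[of X n]
  by (auto simp: GL_def)

lemma GL_I_inverse: "X \<in> carrier_mat n n \<Longrightarrow> Y \<in> carrier_mat n n \<Longrightarrow> X * Y = 1\<^sub>m n \<Longrightarrow> X \<in> GL n"
  using det_mult[of X n Y] by (auto simp: GL_iff_det)

text \<open>Over a field a square matrix with trivial kernel has nonzero determinant. Invertibility
  of block matrices is proved in this form, by solving the homogeneous system block by
  block.\<close>

lemma GL_I_kernel:
  assumes "X \<in> carrier_mat n n" "\<And>v. v \<in> carrier_vec n \<Longrightarrow> X *\<^sub>v v = 0\<^sub>v n \<Longrightarrow> v = 0\<^sub>v n"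
  shows "X \<in> GL n"
  using assms det_0_iff_vec_prod_zero_field[OF assms(1)] by (auto simp: GL_iff_det)

lemma GL_kernel:
  assumes "X \<in> GL n" "v \<in> carrier_vec n" "X *\<^sub>v v = 0\<^sub>v n"
  shows "v = 0\<^sub>v n"
  using assms det_0_iff_vec_prod_zero_field[OF GL_carrier[OF assms(1)]] by (auto simp: GL_iff_det)

lemma GL_transpose: "X \<in> GL n \<Longrightarrow> transpose_mat X \<in> GL n"
  by (auto simp: GL_iff_det det_transpose)

lemma GL_smult: "X \<in> GL n \<Longrightarrow> c \<noteq> 0 \<Longrightarrow> c \<cdot>\<^sub>m X \<in> GL n"
  by (simp add: GL_iff_det)

lemma GL_mult: "X \<in> GL n \<Longrightarrow> Y \<in> GL n \<Longrightarrow> X * Y \<in> GL n"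
  by (auto simp: GL_iff_det det_mult)

lemma mat_inv_props:
  assumes "X \<in> GL n"
  shows mat_inv_carrier: "mat_inv n X \<in> carrier_mat n n"
    and mat_inv_left: "mat_inv n X * X = 1\<^sub>m n"
    and mat_inv_right: "X * mat_inv n X = 1\<^sub>m n"
proof -
  interpret R: semiring "ring_mat TYPE('a) n ()" by (rule semiring_mat)
  show "mat_inv n X \<in> carrier_mat n n" "mat_inv n X * X = 1\<^sub>m n" "X * mat_inv n X = 1\<^sub>m n"
    using R.Units_inv_closed[of X] R.Units_l_inv[of X] R.Units_r_inv[of X] assms
    unfolding GL_def mat_inv_def by (auto simp: ring_mat_simps)
qed

lemma mat_inv_GL: "X \<in> GL n \<Longrightarrow> mat_inv n X \<in> GL n"
  using GL_I_inverse mat_inv_carrier mat_inv_left GL_carrier by blast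

lemma mat_inv_mult_cancel:
  assumes "X \<in> GL n" "Y \<in> carrier_mat n k"
  shows mat_inv_mult_cancel_left: "mat_inv n X * (X * Y) = Y"
    and mult_mat_inv_cancel_left: "X * (mat_inv n X * Y) = Y"
  using assms mat_inv_props[OF assms(1)] GL_carrier[OF assms(1)]
  by (simp_all del: assoc_mult_mat flip: assoc_mult_mat[of _ n n _ n _ k])

text \<open>If \<open>Y\<close> kills a column \<open>v\<close>, then
  \<open>b2 v = a1 X v = b1 (Z^-1 X v)\<close>, a relation between the entries of \<open>b1\<close>
  and \<open>b2\<close> whose coefficients on \<open>b2\<close> form \<open>v\<close>; so
  \<open>v = 0\<close>. This provides the invertible diagonal blocks in both directions of the
  theorem.\<close>

lemma lin_indep_imp_GL:
  assumes ind: "lin_indep_entries (b1 @\<^sub>v b2)"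
    and a1: "a1 \<in> carrier_vec n" and a2: "a2 \<in> carrier_vec k"
    and Z: "Z \<in> GL n" and X: "X \<in> carrier_mat n k" and Y: "Y \<in> carrier_mat k k"
    and b1: "b1 = row_times a1 Z" and b2: "b2 = row_times a1 X + row_times a2 Y"
  shows "Y \<in> GL k"
proof (rule GL_I_kernel[OF Y])
  fix v :: "'a vec" assume v: "v \<in> carrier_vec k" and Yv: "Y *\<^sub>v v = 0\<^sub>v k"
  \<comment> \<open>The vector is recast as a matrix with one column, the form that
    \<open>row_times\<close> multiplies and the independence lemma expects.\<close>
  define V where "V = mat k 1 (\<lambda>(i, _). v $ i)"
  have V: "V \<in> carrier_mat k 1" by (simp add: V_def)
  have YV: "Y * V = 0\<^sub>m k 1"
  proof (rule eq_matI)
    fix i j assume "i < dim_row (0\<^sub>m k 1 :: 'a mat)" "j < dim_col (0\<^sub>m k 1 :: 'a mat)"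
    hence ij: "i < k" "j = 0" by auto
    have "col V 0 = v" using v by (intro eq_vecI) (auto simp: V_def)
    hence "(Y * V) $$ (i, j) = (Y *\<^sub>v v) $ i" using ij Y V by simp
    thus "(Y * V) $$ (i, j) = 0\<^sub>m k 1 $$ (i, j)" using Yv ij by simp
  qed (use Y V in auto)
  note Zc = GL_carrier[OF Z] note Zi = mat_inv_carrier[OF Z]
  thm refl
  have "row_times b2 V = row_times a1 (X * V) + row_times a2 (Y * V)"
    unfolding b2 using a1 a2 X Y V by (simp add: row_times_add_vec[OF V] row_times_mult)
  also have "\<dots> = row_times a1 (X * V)"
    using a2 right_zero_vec[OF row_times_carrier[OF mult_carrier_mat[OF X V]]] by (simp add: YV)
  also have "X * V = Z * (mat_inv n Z * (X * V))"
    using mult_mat_inv_cancel_left[OF Z, of "X * V" 1] X V by simp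
  also have "row_times a1 \<dots> = row_times b1 (mat_inv n Z * (X * V))"
    unfolding b1 by (rule row_times_mult[OF Zc _ a1, symmetric, of _ 1]) (use Zi X V in simp)
  finally have eq: "row_times b2 V = row_times b1 (mat_inv n Z * (X * V))" .
  have b: "b1 \<in> carrier_vec n" "b2 \<in> carrier_vec k"
    using row_times_carrier[OF Zc, of a1] row_times_carrier[OF X, of a1]
      row_times_carrier[OF Y, of a2] by (simp_all add: b1 b2)
  have W: "mat_inv n Z * (X * V) \<in> carrier_mat n 1"
    by (intro mult_carrier_mat[OF Zi] mult_carrier_mat[OF X V])
  have "row_times b1 (- (mat_inv n Z * (X * V))) + row_times b2 V = 0\<^sub>v 1"
    using b W V by (simp add: eq row_times_uminus[OF W])
  hence "V = 0\<^sub>m k 1"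
    using lin_indep_appendD(2)[OF ind b _ V, of "- (mat_inv n Z * (X * V))"] W by simp
  thus "v = 0\<^sub>v k"
    using v by (auto simp: V_def mat_eq_iff intro!: eq_vecI)
qed

subsection \<open>The quadratic part\<close>

lemma row_times_smult:
  "M \<in> carrier_mat n k \<Longrightarrow> a \<in> carrier_vec n \<Longrightarrow>
    row_times a (c \<cdot>\<^sub>m M) = [:c:] \<cdot>\<^sub>v row_times a M"
  by (intro eq_vecI) (auto simp: index_row_times[where n = n and k = k] smult_sum_right)

text \<open>Moving \<open>N\<close> to the other factor transposes it. Substituting
  \<open>a Q\<close> into a bilinear form thus replaces its matrix \<open>M\<close> by
  \<open>Q M Q^T\<close>.\<close>

lemma row_times_scalar_prod_row_times:
  assumes M: "M \<in> carrier_mat n k" and N: "N \<in> carrier_mat n k"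
    and a: "a \<in> carrier_vec n" and b: "b \<in> carrier_vec n"
  shows "row_times a M \<bullet> row_times b N = row_times a (M * transpose_mat N) \<bullet> b"
proof -
  have "row_times b N \<bullet> row_times a M = b \<bullet> (const_mat N *\<^sub>v row_times a M)"
    using transpose_vec_mult_scalar[of "const_mat N" n k "row_times a M" b] M N b
      row_times_carrier[OF M, of a] by (simp add: row_times_def)
  moreover have "const_mat N *\<^sub>v row_times a M = row_times (row_times a M) (transpose_mat N)"
    by (simp add: row_times_def const_mat_transpose)
  moreover have "\<dots> = row_times a (M * transpose_mat N)"
    using M N a by (subst row_times_mult) auto
  moreover have "row_times a (M * transpose_mat N) \<in> carrier_vec n"
    using M N by (intro row_times_carrier[where n = n]) auto
  ultimately show ?thesis
    using row_times_carrier[OF M, of a] row_times_carrier[OF N, of b] b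
    by (simp add: comm_scalar_prod[of _ k] comm_scalar_prod[of _ n])
qed

lemma row_times_scalar_prod:
  assumes "M \<in> carrier_mat n n" "a \<in> carrier_vec n"
  shows "row_times a M \<bullet> a = (\<Sum>j<n. \<Sum>i<n. smult (M $$ (i, j)) (a $ i * a $ j))"
  using assms by (auto simp: scalar_prod_def index_row_times[where n = n and k = n]
      lessThan_atLeast0 sum_distrib_right intro!: sum.cong)

text \<open>Separates the squares from the mixed terms, each unordered pair of indices being met
  once; in characteristic 2 the two kinds behave differently.\<close>

lemma sum_square_split:
  fixes f :: "nat \<Rightarrow> nat \<Rightarrow> 'b::comm_monoid_add"
  shows "(\<Sum>j<n. \<Sum>i<n. f i j) = (\<Sum>j<n. f j j) + (\<Sum>j<n. \<Sum>i<j. f i j + f j i)"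
proof (induction n)
  case (Suc n)
  have "(\<Sum>j<Suc n. \<Sum>i<Suc n. f i j) =
      (\<Sum>j<n. \<Sum>i<n. f i j) + (\<Sum>i<n. f i n) + ((\<Sum>j<n. f n j) + f n n)"
    by (simp add: sum.distrib)
  with Suc show ?case by (simp add: sum.distrib ac_simps)
qed simp

text \<open>The part of the corner entry of \<open>hslash\<close> that depends on \<open>S\<close>:
  the corner is \<open>\<alpha> + quad a1 S\<close>. In characteristic 2 the sum over pairs stands
  in for half of the quadratic form.\<close>

definition quad :: "'a::field poly vec \<Rightarrow> 'a mat \<Rightarrow> 'a poly" where
  "quad a S = (if CHAR('a) = 2
     then \<Sum>j<dim_vec a. \<Sum>i<j. smult (S $$ (i, j)) (a $ i * a $ j)
     else smult (1 / 2) (row_times a S \<bullet> a))"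

lemma strict_upper_carrier [simp]: "M \<in> carrier_mat n k \<Longrightarrow> strict_upper M \<in> carrier_mat n k"
  by (simp add: strict_upper_def)

text \<open>Only the entries above the diagonal contribute, so the form is the value of a
  non-symmetric bilinear form, to which the change of basis applies as usual.\<close>

lemma quad_char_2:
  assumes "CHAR('a::field) = 2" and S: "S \<in> carrier_mat n n" and a: "a \<in> carrier_vec n"
  shows "quad (a :: 'a poly vec) S = row_times a (strict_upper S) \<bullet> a"
proof -
  have "row_times a (strict_upper S) \<bullet> a =
      (\<Sum>j<n. \<Sum>i<j. smult (strict_upper S $$ (i, j) + strict_upper S $$ (j, i)) (a $ i * a $ j))"
    unfolding row_times_scalar_prod[OF strict_upper_carrier[OF S] a] sum_square_split
    using S by (auto simp: strict_upper_def smult_add_left mult.commute intro!: sum.cong)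
  also have "\<dots> = quad a S"
    using assms unfolding quad_def by (auto simp: strict_upper_def intro!: sum.cong)
  finally show ?thesis ..
qed

text \<open>The trace of \<open>diag(a) R diag(a)\<close>, with \<open>R = Q U Q^T\<close>, reads
  off the diagonal of \<open>R\<close>, each entry weighted by the square of the matching entry of
  \<open>a\<close>.\<close>

lemma Delta_char_2:
  assumes "CHAR('a::field) = 2" and a: "a \<in> carrier_vec n"
    and Q: "Q \<in> carrier_mat n n" and U: "U \<in> carrier_mat n n"
  shows "Delta (a :: 'a poly vec) Q U =
    (\<Sum>i<n. smult ((Q * U * transpose_mat Q) $$ (i, i)) (a $ i * a $ i))"
proof -
  let ?R = "Q * U * transpose_mat Q" and ?D = "mat_diag n (\<lambda>i. a $ i)"
  have R: "?R \<in> carrier_mat n n" using Q U by simp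
  have "?D * const_mat Q * const_mat U * transpose_mat (const_mat Q) * ?D = ?D * const_mat ?R * ?D"
    using Q U by (simp add: const_mat_mult[of _ n n _ n] const_mat_transpose
        assoc_mult_mat[of _ n n _ n _ n])
  also have "?D * const_mat ?R = mat n n (\<lambda>(i, j). a $ i * const_mat ?R $$ (i, j))"
    using R by (intro mat_diag_mult_left) simp
  also have "\<dots> * ?D = mat n n (\<lambda>(i, j). a $ i * const_mat ?R $$ (i, j) * a $ j)"
    by (subst mat_diag_mult_right) (auto intro!: eq_matI)
  also have "mat_trace \<dots> = (\<Sum>i<n. a $ i * const_mat ?R $$ (i, i) * a $ i)"
    by (simp add: mat_trace_def diag_mat_def atLeast_upt lessThan_atLeast0 interv_sum_list_conv_sum_set_nat)
  also have "\<dots> = (\<Sum>i<n. smult (?R $$ (i, i)) (a $ i * a $ i))"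
    using R Q by (intro sum.cong) auto
  finally show ?thesis using assms(1) a by (simp add: Delta_def Let_def)
qed

text \<open>In characteristic \<open>2\<close> the form attached to \<open>S\<close> only sees \<open>S\<close> above the diagonal, and a
  change of basis creates the squares collected in \<open>Delta\<close>.\<close>

lemma quad_change_of_basis:
  fixes a :: "'a::field poly vec"
  assumes a: "a \<in> carrier_vec n" and S: "S \<in> carrier_mat n n" and Q: "Q \<in> carrier_mat n n"
    and S': "S' \<in> GLss n"
    and eq: "Q * S' * transpose_mat Q = c \<cdot>\<^sub>m S"
  shows "quad (row_times a Q) S' = smult c (quad a S) + Delta a Q (strict_upper S')"
proof -
  have S'c: "S' \<in> carrier_mat n n" and sym: "transpose_mat S' = S'"
    and diag: "CHAR('a) = 2 \<Longrightarrow> i < n \<Longrightarrow> S' $$ (i, i) = 0" for i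
    using S' GL_carrier[of S' n] by (auto simp: GLss_def)
  \<comment> \<open>Stated for an arbitrary \<open>M\<close>, because in characteristic 2 it is
    applied to the strictly upper triangular part of \<open>S'\<close>, otherwise to
    \<open>S'\<close> itself.\<close>
  have form: "row_times (row_times a Q) M \<bullet> row_times a Q
      = row_times a (Q * M * transpose_mat Q) \<bullet> a" if M: "M \<in> carrier_mat n n" for M
    using a Q M by (simp add: row_times_mult[of _ n n _ n]
        row_times_scalar_prod_row_times[of _ n n])
  show ?thesis
  proof (cases "CHAR('a) = 2")
    case False
    have "row_times a (c \<cdot>\<^sub>m S) \<bullet> a = smult c (row_times a S \<bullet> a)"
      using a S by (simp add: row_times_smult[of _ n n]
          smult_scalar_prod_distrib[of _ n])
    thus ?thesis
      using False S'c by (simp add: quad_def Delta_def form eq mult.commute)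
  next
    case True
    define U where "U = strict_upper S'"
    define R where "R = Q * U * transpose_mat Q"
    have U: "U \<in> carrier_mat n n" and R: "R \<in> carrier_mat n n" using S'c Q by (auto simp: U_def R_def)
    \<comment> \<open>Symmetry produces the two triangles; the zero diagonal that
      \<open>GLss\<close> demands in characteristic 2 leaves nothing else.\<close>
    have "S' = U + transpose_mat U"
    proof (rule eq_matI)
      fix i j assume "i < dim_row (U + transpose_mat U)" "j < dim_col (U + transpose_mat U)"
      hence ij: "i < n" "j < n" using U by auto
      have "S' $$ (i, j) = S' $$ (j, i)" using ij S'c arg_cong[OF sym, of "\<lambda>X. X $$ (i, j)"] by simp
      thus "S' $$ (i, j) = (U + transpose_mat U) $$ (i, j)"
        using ij S'c diag[OF True, of i] by (cases i j rule: linorder_cases) (auto simp: U_def strict_upper_def)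
    qed (use U S'c in auto)
    hence "Q * S' * transpose_mat Q = Q * (U + transpose_mat U) * transpose_mat Q" by simp
    also have "\<dots> = R + Q * transpose_mat U * transpose_mat Q"
      using Q U by (simp add: R_def mult_add_distrib_mat[of _ n n] add_mult_distrib_mat[of _ n n])
    also have "Q * transpose_mat U * transpose_mat Q = transpose_mat R"
      using Q U by (simp add: R_def transpose_mult[of _ n n _ n] assoc_mult_mat[of _ n n _ n _ n])
    finally have cS: "c \<cdot>\<^sub>m S = R + transpose_mat R" using eq by simp
    \<comment> \<open>The sum of opposite entries of \<open>R\<close> is all that the mixed terms
      require. The diagonal entries of \<open>R\<close> survive as coefficients of squares and make
      up \<open>Delta\<close>.\<close>
    have ent: "c * S $$ (i, j) = R $$ (i, j) + R $$ (j, i)" if "i < n" "j < n" for i j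
      using arg_cong[OF cS, of "\<lambda>X. X $$ (i, j)"] that S R by simp
    have "quad (row_times a Q) S' = row_times a R \<bullet> a"
      using quad_char_2[OF True S'c, of "row_times a Q"] form[OF U] Q by (simp add: U_def R_def)
    also have "\<dots> = (\<Sum>j<n. smult (R $$ (j, j)) (a $ j * a $ j)) +
        (\<Sum>j<n. \<Sum>i<j. smult (c * S $$ (i, j)) (a $ i * a $ j))"
      unfolding row_times_scalar_prod[OF R a] sum_square_split
      by (auto simp: ent smult_add_left mult.commute intro!: sum.cong arg_cong2[of _ _ _ _ "(+)"])
    also have "(\<Sum>j<n. smult (R $$ (j, j)) (a $ j * a $ j)) = Delta a Q U"
      using Delta_char_2[OF True a Q U] by (simp add: R_def)
    also have "(\<Sum>j<n. \<Sum>i<j. smult (c * S $$ (i, j)) (a $ i * a $ j)) = smult c (quad a S)"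
      using a True by (simp add: quad_def smult_sum_right)
    finally show ?thesis by (simp add: U_def)
  qed
qed

subsection \<open>Bordered matrices\<close>

text \<open>The matrix \<open>h_mat\<close> seen through the coarser block sizes 1, m, 1:
  \<open>u\<close> is the middle of the first row, \<open>w\<close> the middle of the last column.
  The finer blocks inside \<open>u\<close> and \<open>w\<close> enter only after conjugation has
  been analysed.\<close>

definition bordered_mat :: "nat \<Rightarrow> 'a poly vec \<Rightarrow> 'a poly vec \<Rightarrow> 'a poly \<Rightarrow> 'a::field poly mat" where
  "bordered_mat m u w \<phi> = mat (m + 2) (m + 2) (\<lambda>(i, j).
     if i = 0 then (if j = 0 then 1 else if j = Suc m then \<phi> else u $ (j - 1))
     else if j = Suc m then (if i = Suc m then 1 else w $ (i - 1))
     else if i = j then 1 else 0)"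

lemma vec_of_list_singleton: "vec_of_list [x] = vec 1 (\<lambda>_. x)"
  by (rule eq_vecI) (auto simp: vec_of_list_index)

lemma append_vec_assoc: "(a @\<^sub>v b) @\<^sub>v c = a @\<^sub>v b @\<^sub>v c"
  by (rule eq_vecI) (auto simp: less_diff_conv2 diff_diff_left)

lemma h_mat_eq_bordered_mat:
  assumes "a1 \<in> carrier_vec r1" "a2 \<in> carrier_vec (l - r1)" "\<alpha>1 \<in> carrier_vec r1"
    "\<alpha>2 \<in> carrier_vec r2" "r1 \<le> l" "l + r2 \<le> m"
  shows "h_mat m l r1 r2 a1 a2 \<alpha>1 \<alpha>2 \<phi> = bordered_mat m
    (a1 @\<^sub>v a2 @\<^sub>v 0\<^sub>v r2 @\<^sub>v 0\<^sub>v (m - l - r2))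
    (\<alpha>1 @\<^sub>v 0\<^sub>v (l - r1) @\<^sub>v \<alpha>2 @\<^sub>v 0\<^sub>v (m - l - r2)) \<phi>"
proof -
  define u where "u = a1 @\<^sub>v a2 @\<^sub>v 0\<^sub>v r2 @\<^sub>v 0\<^sub>v (m - l - r2)"
  define w where "w = \<alpha>1 @\<^sub>v 0\<^sub>v (l - r1) @\<^sub>v \<alpha>2 @\<^sub>v 0\<^sub>v (m - l - r2)"
  have dims: "dim_vec u = m" "dim_vec w = m" using assms by (auto simp: u_def w_def)
  define fr where "fr = vec_of_list [1] @\<^sub>v u @\<^sub>v vec_of_list [\<phi>]"
  define lc where "lc = vec_of_list [\<phi>] @\<^sub>v w @\<^sub>v vec_of_list [1]"
  have row: "fr $ j = (if j = 0 then 1 else if j = Suc m then \<phi> else u $ (j - 1))" if "j < m + 2" for j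
    unfolding fr_def vec_of_list_singleton using that dims by (cases j) auto
  have col: "lc $ i = (if i = 0 then \<phi> else if i = Suc m then 1 else w $ (i - 1))" if "i < m + 2" for i
    unfolding lc_def vec_of_list_singleton using that dims by (cases i) auto
  have rows: "vec_of_list [1] @\<^sub>v a1 @\<^sub>v a2 @\<^sub>v 0\<^sub>v r2 @\<^sub>v 0\<^sub>v (m - l - r2) @\<^sub>v vec_of_list [\<phi>] = fr"
    and cols: "vec_of_list [\<phi>] @\<^sub>v \<alpha>1 @\<^sub>v 0\<^sub>v (l - r1) @\<^sub>v \<alpha>2 @\<^sub>v 0\<^sub>v (m - l - r2) @\<^sub>v vec_of_list [1] = lc"
    unfolding u_def w_def fr_def lc_def append_vec_assoc by (rule refl)+
  show ?thesis
    unfolding h_mat_def Let_def rows cols u_def[symmetric] w_def[symmetric]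
    by (rule eq_matI) (auto simp: bordered_mat_def row col)
qed

section \<open>Conjugation of bordered matrices\<close>

lemma equivalent_mats_iff_intertwined:
  assumes A: "A \<in> carrier_mat n n" and B: "B \<in> carrier_mat n n"
  shows "equivalent_mats n A B \<longleftrightarrow> (\<exists>P\<in>GL n. A * const_mat P = const_mat P * B)"
proof -
  have "const_mat (mat_inv n P) * A * const_mat P = B \<longleftrightarrow> A * const_mat P = const_mat P * B"
    if P: "P \<in> GL n" for P
  proof -
    let ?P = "const_mat P" and ?Q = "const_mat (mat_inv n P)"
    have c: "?P \<in> carrier_mat n n" "?Q \<in> carrier_mat n n"
      using GL_carrier[OF P] mat_inv_carrier[OF P] by simp_all
    have inv: "?P * ?Q = 1\<^sub>m n" "?Q * ?P = 1\<^sub>m n"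
      using mat_inv_left[OF P] mat_inv_right[OF P] GL_carrier[OF P] mat_inv_carrier[OF P]
      by (simp_all flip: const_mat_mult[of _ n n _ n])
    show ?thesis
    proof
      assume "?Q * A * ?P = B"
      hence "?P * B = ?P * ?Q * (A * ?P)"
        using c A by (auto simp: assoc_mult_mat[of _ n n _ n _ n])
      thus "A * ?P = ?P * B" using A c by (simp add: inv)
    next
      assume "A * ?P = ?P * B"
      hence "?Q * A * ?P = ?Q * ?P * B"
        using c A B by (simp add: assoc_mult_mat[of _ n n _ n _ n])
      thus "?Q * A * ?P = B" using B by (simp add: inv)
    qed
  qed
  thus ?thesis unfolding equivalent_mats_def by blast
qed

lemma bordered_mat_carrier [simp]: "bordered_mat m u w \<phi> \<in> carrier_mat (m + 2) (m + 2)"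
  by (simp add: bordered_mat_def)

lemma border_index_cases: "i < m + 2 \<Longrightarrow> i = 0 \<or> i = Suc m \<or> (\<exists>k<m. i = Suc k)"
  by (cases i) (auto simp: less_Suc_eq)

lemma sum_lessThan_border:
  "(\<Sum>k<m + 2. f k) = f 0 + (\<Sum>k<m. f (Suc k)) + (f (Suc m) :: 'b::comm_monoid_add)"
  using sum.lessThan_Suc[of f "Suc m"] sum.lessThan_Suc_shift[of f m] by simp

lemma index_mult_mat_border:
  "M \<in> carrier_mat (m + 2) (m + 2) \<Longrightarrow> N \<in> carrier_mat (m + 2) (m + 2) \<Longrightarrow> i < m + 2 \<Longrightarrow> j < m + 2 \<Longrightarrow>
    (M * N) $$ (i, j) = M $$ (i, 0) * N $$ (0, j) + (\<Sum>k<m. M $$ (i, Suc k) * N $$ (Suc k, j))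
      + M $$ (i, Suc m) * N $$ (Suc m, j)"
  unfolding sum_lessThan_border[of "\<lambda>k. M $$ (i, k) * N $$ (k, j)", symmetric]
  by (auto simp: scalar_prod_def lessThan_atLeast0)

lemma sum_delta_mult:
  fixes f :: "nat \<Rightarrow> 'b::comm_ring_1"
  assumes "i < m"
  shows "(\<Sum>k<m. (if i = k then 1 else 0) * f k) = f i"
  using assms by (simp add: if_distrib[of "\<lambda>x. x * _"] cong: if_cong)

text \<open>Below its first row a bordered matrix differs from the identity only in the last column,
  so a genuine sum occurs only in the first row of the product.\<close>

lemma bordered_mat_mult_index:
  assumes P: "P \<in> carrier_mat (m + 2) (m + 2)" and j: "j < m + 2"
  shows "(bordered_mat m u w \<phi> * const_mat P) $$ (0, j) =
      [:P $$ (0, j):] + (\<Sum>k<m. smult (P $$ (Suc k, j)) (u $ k)) + smult (P $$ (Suc m, j)) \<phi>"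
    and "i < m \<Longrightarrow> (bordered_mat m u w \<phi> * const_mat P) $$ (Suc i, j) =
      [:P $$ (Suc i, j):] + smult (P $$ (Suc m, j)) (w $ i)"
    and "(bordered_mat m u w \<phi> * const_mat P) $$ (Suc m, j) = [:P $$ (Suc m, j):]"
proof -
  have cP: "const_mat P \<in> carrier_mat (m + 2) (m + 2)" using P by simp
  have d: "dim_row P = m + 2" "dim_col P = m + 2" using P by auto
  note e = index_mult_mat_border[OF bordered_mat_carrier cP _ j]
  show "(bordered_mat m u w \<phi> * const_mat P) $$ (0, j) =
      [:P $$ (0, j):] + (\<Sum>k<m. smult (P $$ (Suc k, j)) (u $ k)) + smult (P $$ (Suc m, j)) \<phi>"
    using j by (simp add: e) (simp add: bordered_mat_def d mult.commute)
  show "(bordered_mat m u w \<phi> * const_mat P) $$ (Suc m, j) = [:P $$ (Suc m, j):]"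
    using j by (simp add: e) (simp add: bordered_mat_def d)
  assume i: "i < m"
  have "(\<Sum>k<m. (if i = k then 1 else 0) * [:P $$ (Suc k, j):]) = [:P $$ (Suc i, j):]"
    by (rule sum_delta_mult[OF i])
  thus "(bordered_mat m u w \<phi> * const_mat P) $$ (Suc i, j) =
      [:P $$ (Suc i, j):] + smult (P $$ (Suc m, j)) (w $ i)"
    using i j by (simp add: e) (simp add: bordered_mat_def d mult.commute)
qed

text \<open>Left of its last column a bordered matrix differs from the identity only in the first
  row, so a genuine sum occurs only in the last column of the product.\<close>

lemma mult_bordered_mat_index:
  assumes P: "P \<in> carrier_mat (m + 2) (m + 2)" and i: "i < m + 2"
  shows "(const_mat P * bordered_mat m u w \<phi>) $$ (i, 0) = [:P $$ (i, 0):]"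
    and "j < m \<Longrightarrow> (const_mat P * bordered_mat m u w \<phi>) $$ (i, Suc j) =
      smult (P $$ (i, 0)) (u $ j) + [:P $$ (i, Suc j):]"
    and "(const_mat P * bordered_mat m u w \<phi>) $$ (i, Suc m) =
      smult (P $$ (i, 0)) \<phi> + (\<Sum>k<m. smult (P $$ (i, Suc k)) (w $ k)) + [:P $$ (i, Suc m):]"
proof -
  have cP: "const_mat P \<in> carrier_mat (m + 2) (m + 2)" using P by simp
  have d: "dim_row P = m + 2" "dim_col P = m + 2" using P by auto
  note e = index_mult_mat_border[OF cP bordered_mat_carrier i]
  show "(const_mat P * bordered_mat m u w \<phi>) $$ (i, 0) = [:P $$ (i, 0):]"
    using i by (simp add: e) (simp add: bordered_mat_def d)
  show "(const_mat P * bordered_mat m u w \<phi>) $$ (i, Suc m) =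
      smult (P $$ (i, 0)) \<phi> + (\<Sum>k<m. smult (P $$ (i, Suc k)) (w $ k)) + [:P $$ (i, Suc m):]"
    using i by (simp add: e) (simp add: bordered_mat_def d)
  assume j: "j < m"
  have "(\<Sum>k<m. [:P $$ (i, Suc k):] * (if k = j then 1 else 0)) = [:P $$ (i, Suc j):]"
    using sum_delta_mult[OF j, of "\<lambda>k. [:P $$ (i, Suc k):]"] by (simp only: mult.commute eq_commute[of j])
  thus "(const_mat P * bordered_mat m u w \<phi>) $$ (i, Suc j) =
      smult (P $$ (i, 0)) (u $ j) + [:P $$ (i, Suc j):]"
    using i j by (simp add: e) (simp add: bordered_mat_def d)
qed

text \<open>A zero column would put a unit vector into the kernel.\<close>

lemma GL_column_neq_zero:
  assumes P: "P \<in> GL n" and j: "j < n"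
  shows "\<exists>i<n. P $$ (i, j) \<noteq> 0"
proof (rule ccontr)
  assume "\<not> ?thesis"
  hence "P *\<^sub>v unit_vec n j = 0\<^sub>v n"
    using GL_carrier[OF P] j by (auto simp: mult_mat_vec_def intro!: eq_vecI)
  hence "unit_vec n j = (0\<^sub>v n :: 'a vec)" using GL_kernel[OF P] by simp
  thus False using j by (metis index_unit_vec(1) index_zero_vec(1) zero_neq_one)
qed

lemma GL_row_neq_zero: "P \<in> GL n \<Longrightarrow> i < n \<Longrightarrow> \<exists>j<n. P $$ (i, j) \<noteq> 0"
  using GL_column_neq_zero[OF GL_transpose, of P n i] GL_carrier[of P n] by auto

text \<open>Comparing the entries of \<open>A P = P B\<close> shows that \<open>P\<close> is block
  upper triangular; its middle block, divided by one or the other corner, then gives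
  \<open>Q\<close> and the transpose of \<open>R\<close>. Since \<open>u\<close> may end in zeros,
  \<open>ind\<close> asks only that the first coefficient of a relation vanish, which is enough to
  start the elimination.\<close>

lemma equivalent_bordered_matD:
  assumes m: "m \<ge> 1" and u: "u \<in> carrier_vec m" and w: "w \<in> carrier_vec m"
    and u': "u' \<in> carrier_vec m" and w': "w' \<in> carrier_vec m"
    and u'0: "u' $ 0 \<noteq> 0" and w0: "w $ 0 \<noteq> 0"
    and ind: "\<And>c. (\<Sum>k<m. smult (c k) (u $ k)) = 0 \<Longrightarrow> c 0 = 0"
    and eqv: "equivalent_mats (m + 2) (bordered_mat m u w \<phi>) (bordered_mat m u' w' \<phi>')"
  obtains c Q R X Y where "c \<noteq> 0" "Q \<in> carrier_mat m m" "R \<in> carrier_mat m m"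
    "X \<in> carrier_mat m 1" "Y \<in> carrier_mat m 1" "c \<cdot>\<^sub>m R = transpose_mat Q"
    "row_times u Q = u'" "row_times w' R = w"
    "\<phi>' = smult c \<phi> + row_times u X $ 0 - row_times w' Y $ 0"
proof -
  obtain P where P: "P \<in> GL (m + 2)"
    and eq: "bordered_mat m u w \<phi> * const_mat P = const_mat P * bordered_mat m u' w' \<phi>'"
    using eqv unfolding equivalent_mats_iff_intertwined[OF bordered_mat_carrier bordered_mat_carrier]
    by blast
  note Pc = GL_carrier[OF P]
  note L = bordered_mat_mult_index[OF Pc] and R = mult_bordered_mat_index[OF Pc]
  have e: "(bordered_mat m u w \<phi> * const_mat P) $$ (i, j) = (const_mat P * bordered_mat m u' w' \<phi>') $$ (i, j)"
    for i j by (simp add: eq)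
  \<comment> \<open>In the entry (1, 0) the constants cancel and leave this entry of
    \<open>P\<close> times \<open>w $ 0\<close>.\<close>
  have P20: "P $$ (Suc m, 0) = 0"
    using e[of "Suc 0" 0] m w0 L(2)[of 0 0] R(1)[of 1] by simp
  \<comment> \<open>The entry (0, 0) is a relation between the entries of \<open>u\<close> whose
    coefficients come from the first column of \<open>P\<close>.\<close>
  have P10_0: "P $$ (Suc 0, 0) = 0"
    using ind[of "\<lambda>k. P $$ (Suc k, 0)"] e[of 0 0] L(1)[of 0] R(1)[of 0] by (simp add: P20)
  \<comment> \<open>Row 1 again: with \<open>P10_0\<close>, what remains in column j + 1 is the last
    row of \<open>P\<close> times \<open>w $ 0\<close>.\<close>
  have P21: "P $$ (Suc m, Suc j) = 0" if "j < m" for j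
    using e[of "Suc 0" "Suc j"] m w0 that L(2)[of "Suc j" 0] R(2)[of "Suc 0" j] by (simp add: P10_0)
  \<comment> \<open>Column 1: with \<open>P21\<close>, what remains in row i + 1 is the first column
    of \<open>P\<close> times \<open>u' $ 0\<close>.\<close>
  have P10: "P $$ (Suc i, 0) = 0" if "i < m" for i
    using e[of "Suc i" "Suc 0"] m u'0 that L(2)[of "Suc 0" i] R(2)[of "Suc i" 0] P21[of 0] by simp
  define p where "p = P $$ (0, 0)"
  define q where "q = P $$ (Suc m, Suc m)"
  \<comment> \<open>All other entries of the first column vanish, and likewise for the last row and
    \<open>q\<close>; an invertible matrix has no zero row or column.\<close>
  have p: "p \<noteq> 0"
    using GL_column_neq_zero[OF P, of 0] border_index_cases P20 P10 by (auto simp: p_def)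
  have q: "q \<noteq> 0"
    using GL_row_neq_zero[OF P, of "Suc m"] border_index_cases P20 P21 by (auto simp: q_def)
  define c where "c = q / p"
  define Q where "Q = mat m m (\<lambda>(i, j). P $$ (Suc i, Suc j) / p)"
  \<comment> \<open>The same middle block as in \<open>Q\<close>, transposed because
    \<open>w'\<close> is multiplied as a row, and divided by the other corner; hence the factor
    \<open>c = q / p\<close> between \<open>R\<close> and the transpose of \<open>Q\<close>.\<close>
  define R where "R = mat m m (\<lambda>(i, j). P $$ (Suc j, Suc i) / q)"
  define X where "X = mat m 1 (\<lambda>(i, j). P $$ (Suc i, Suc m) / p)"
  define Y where "Y = mat m 1 (\<lambda>(i, j). P $$ (0, Suc i) / p)"
  have carr: "Q \<in> carrier_mat m m" "R \<in> carrier_mat m m" "X \<in> carrier_mat m 1" "Y \<in> carrier_mat m 1"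
    by (auto simp: Q_def R_def X_def Y_def)
  have eq_Q: "row_times u Q = u'"
  proof (rule eq_vecI)
    fix j assume "j < dim_vec u'" hence j: "j < m" using u' by simp
    have "(\<Sum>k<m. smult (P $$ (Suc k, Suc j)) (u $ k)) = smult p (u' $ j)"
      using e[of 0 "Suc j"] j L(1)[of "Suc j"] R(2)[of 0 j] by (simp add: P21 p_def)
    moreover have "row_times u Q $ j = (\<Sum>k<m. smult (1 / p) (smult (P $$ (Suc k, Suc j)) (u $ k)))"
      unfolding index_row_times[OF carr(1) u j] using j by (intro sum.cong) (auto simp: Q_def)
    ultimately show "row_times u Q $ j = u' $ j"
      using p unfolding smult_sum_right[symmetric] by simp
  qed (use u' carr in auto)
  have eq_R: "row_times w' R = w"
  proof (rule eq_vecI)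
    fix j assume "j < dim_vec w" hence j: "j < m" using w by simp
    have "(\<Sum>k<m. smult (P $$ (Suc j, Suc k)) (w' $ k)) = smult q (w $ j)"
      using e[of "Suc j" "Suc m"] j L(2)[of "Suc m" j] R(3)[of "Suc j"] by (simp add: P10 q_def)
    moreover have "row_times w' R $ j = (\<Sum>k<m. smult (1 / q) (smult (P $$ (Suc j, Suc k)) (w' $ k)))"
      unfolding index_row_times[OF carr(2) w' j] using j by (intro sum.cong) (auto simp: R_def)
    ultimately show "row_times w' R $ j = w $ j"
      using q unfolding smult_sum_right[symmetric] by simp
  qed (use w carr in auto)
  \<comment> \<open>The corner entry of the intertwining relation; the entry of \<open>P\<close> in
    its own upper right corner occurs on both sides and cancels.\<close>
  have "smult p \<phi>' + (\<Sum>k<m. smult (P $$ (0, Suc k)) (w' $ k)) =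
      (\<Sum>k<m. smult (P $$ (Suc k, Suc m)) (u $ k)) + smult q \<phi>"
    using e[of 0 "Suc m"] L(1)[of "Suc m"] R(3)[of 0] by (simp add: p_def q_def)
  hence "smult p \<phi>' = (\<Sum>k<m. smult (P $$ (Suc k, Suc m)) (u $ k)) + smult q \<phi>
      - (\<Sum>k<m. smult (P $$ (0, Suc k)) (w' $ k))"
    by (simp add: algebra_simps)
  hence "smult (1 / p) (smult p \<phi>') = smult (1 / p) ((\<Sum>k<m. smult (P $$ (Suc k, Suc m)) (u $ k))
      + smult q \<phi> - (\<Sum>k<m. smult (P $$ (0, Suc k)) (w' $ k)))" by simp
  hence "\<phi>' = smult c \<phi> + row_times u X $ 0 - row_times w' Y $ 0"
    using p by (simp add: index_row_times[OF carr(3) u] index_row_times[OF carr(4) w']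
        smult_add_right smult_diff_right smult_sum_right) (simp add: X_def Y_def c_def)
  moreover have "c \<cdot>\<^sub>m R = transpose_mat Q"
    using p q by (auto simp: Q_def R_def c_def)
  moreover have "c \<noteq> 0" using p q by (simp add: c_def)
  ultimately show thesis using that carr eq_Q eq_R by blast
qed

lemma equivalent_bordered_matI:
  assumes u: "u \<in> carrier_vec m" and w: "w \<in> carrier_vec m"
    and u': "u' \<in> carrier_vec m" and w': "w' \<in> carrier_vec m"
    and c: "c \<noteq> 0" and Q: "Q \<in> GL m" and R: "R \<in> carrier_mat m m"
    and X: "X \<in> carrier_mat m 1" and Y: "Y \<in> carrier_mat m 1"
    and cR: "c \<cdot>\<^sub>m R = transpose_mat Q" and eq_Q: "row_times u Q = u'" and eq_R: "row_times w' R = w"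
    and \<phi>': "\<phi>' = smult c \<phi> + row_times u X $ 0 - row_times w' Y $ 0"
  shows "equivalent_mats (m + 2) (bordered_mat m u w \<phi>) (bordered_mat m u' w' \<phi>')"
proof -
  \<comment> \<open>Block upper triangular, scaled so that the first corner is 1 and the last is
    \<open>c\<close>. The upper right corner cancels from the intertwining relation and is set to
    0.\<close>
  define P where "P = mat (m + 2) (m + 2) (\<lambda>(i, j).
    if i = 0 then (if j = 0 then 1 else if j = Suc m then 0 else Y $$ (j - 1, 0))
    else if i = Suc m then (if j = Suc m then c else 0)
    else if j = 0 then 0 else if j = Suc m then X $$ (i - 1, 0) else Q $$ (i - 1, j - 1))"
  have Pc: "P \<in> carrier_mat (m + 2) (m + 2)" by (simp add: P_def)
  have Qc: "Q \<in> carrier_mat m m" by (rule GL_carrier[OF Q])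
  have P_ent [simp]: "P $$ (0, 0) = 1" "P $$ (0, Suc m) = 0" "P $$ (Suc m, Suc m) = c" "P $$ (Suc m, 0) = 0"
    "\<And>j. j < m \<Longrightarrow> P $$ (0, Suc j) = Y $$ (j, 0)" "\<And>j. j < m \<Longrightarrow> P $$ (Suc m, Suc j) = 0"
    "\<And>j. j < m \<Longrightarrow> P $$ (Suc j, 0) = 0" "\<And>j. j < m \<Longrightarrow> P $$ (Suc j, Suc m) = X $$ (j, 0)"
    "\<And>i j. i < m \<Longrightarrow> j < m \<Longrightarrow> P $$ (Suc i, Suc j) = Q $$ (i, j)"
    by (simp_all add: P_def)
  have PGL: "P \<in> GL (m + 2)"
  proof (rule GL_I_kernel[OF Pc])
    fix v :: "'a vec" assume v: "v \<in> carrier_vec (m + 2)" and Pv: "P *\<^sub>v v = 0\<^sub>v (m + 2)"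
    have row_eq: "P $$ (i, 0) * v $ 0 + (\<Sum>k<m. P $$ (i, Suc k) * v $ Suc k) + P $$ (i, Suc m) * v $ Suc m = 0"
      if i: "i < m + 2" for i
    proof -
      have "(P *\<^sub>v v) $ i = (\<Sum>k<m + 2. P $$ (i, k) * v $ k)"
        using i v Pc by (auto simp: scalar_prod_def lessThan_atLeast0)
      thus ?thesis using i unfolding Pv sum_lessThan_border by simp
    qed
    have v2: "v $ Suc m = 0" using row_eq[of "Suc m"] c by simp
    have "vec m (\<lambda>k. v $ Suc k) = 0\<^sub>v m"
    proof (rule GL_kernel[OF Q])
      show "Q *\<^sub>v vec m (\<lambda>k. v $ Suc k) = 0\<^sub>v m"
      proof (rule eq_vecI)
        fix i assume "i < dim_vec (0\<^sub>v m :: 'a vec)"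
        hence i: "i < m" by simp
        have "(Q *\<^sub>v vec m (\<lambda>k. v $ Suc k)) $ i = (\<Sum>k<m. Q $$ (i, k) * v $ Suc k)"
          using i Qc by (auto simp: scalar_prod_def lessThan_atLeast0)
        also have "\<dots> = 0" using row_eq[of "Suc i"] i v2 by simp
        finally show "(Q *\<^sub>v vec m (\<lambda>k. v $ Suc k)) $ i = 0\<^sub>v m $ i" using i by simp
      qed (use Qc in auto)
    qed simp
    hence v1: "v $ Suc k = 0" if "k < m" for k
      using that by (metis index_vec index_zero_vec(1))
    have v0: "v $ 0 = 0" using row_eq[of 0] v1 v2 by simp
    show "v = 0\<^sub>v (m + 2)"
    proof (rule eq_vecI)
      fix i assume "i < dim_vec (0\<^sub>v (m + 2) :: 'a vec)"
      thus "v $ i = 0\<^sub>v (m + 2) $ i" using v0 v1 v2 by (cases i) (auto simp: less_Suc_eq)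
    qed (use v in auto)
  qed
  have cR': "Q $$ (i, j) = c * R $$ (j, i)" if "i < m" "j < m" for i j
    using arg_cong[OF cR, of "\<lambda>M. M $$ (j, i)"] that R Qc by simp
  have "bordered_mat m u w \<phi> * const_mat P = const_mat P * bordered_mat m u' w' \<phi>'"
  proof (rule eq_matI)
    fix i j assume "i < dim_row (const_mat P * bordered_mat m u' w' \<phi>')"
      "j < dim_col (const_mat P * bordered_mat m u' w' \<phi>')"
    hence "i < m + 2" "j < m + 2" using Pc by (auto simp: bordered_mat_def)
    hence i: "i = 0 \<or> i = Suc m \<or> (\<exists>k<m. i = Suc k)" and j: "j = 0 \<or> j = Suc m \<or> (\<exists>k<m. j = Suc k)"
      by (simp_all only: border_index_cases)
    have u'j: "u' $ k = (\<Sum>i<m. smult (Q $$ (i, k)) (u $ i))" if "k < m" for k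
      using index_row_times[OF Qc u that] by (simp add: eq_Q)
    have wj: "smult c (w $ k) = (\<Sum>i<m. smult (Q $$ (k, i)) (w' $ i))" if "k < m" for k
      using index_row_times[OF R w' that] that by (simp add: eq_R smult_sum_right cR')
    show "(bordered_mat m u w \<phi> * const_mat P) $$ (i, j) = (const_mat P * bordered_mat m u' w' \<phi>') $$ (i, j)"
      using i j by (auto simp: bordered_mat_mult_index[OF Pc] mult_bordered_mat_index[OF Pc]
          u'j wj \<phi>' index_row_times[OF X u] index_row_times[OF Y w'])
  qed (use Pc in \<open>auto simp: bordered_mat_def\<close>)
  thus ?thesis
    unfolding equivalent_mats_iff_intertwined[OF bordered_mat_carrier bordered_mat_carrier]
    using PGL by blast
qed

subsection \<open>Block matrices\<close>

text \<open>Inverse to adding a position to \<open>block_start\<close>. Blocks are counted from 0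
  here but from 1 in \<open>mat_block\<close>; an index beyond all blocks gets the number
  \<open>length ns\<close>.\<close>

fun block_index :: "nat list \<Rightarrow> nat \<Rightarrow> nat \<times> nat" where
  "block_index [] k = (0, k)"
| "block_index (n # ns) k =
    (if k < n then (0, k) else let (b, u) = block_index ns (k - n) in (Suc b, u))"

definition block_start :: "nat list \<Rightarrow> nat \<Rightarrow> nat" where
  "block_start ns b = sum_list (take b ns)"

lemma block_start_simps [simp]:
  "block_start ns 0 = 0" "block_start (n # ns) (Suc b) = n + block_start ns b"
  by (simp_all add: block_start_def)

lemma block_index_block_start:
  "b < length ns \<Longrightarrow> u < ns ! b \<Longrightarrow> block_index ns (block_start ns b + u) = (b, u)"
  by (induction ns arbitrary: b) (auto simp: less_Suc_eq_0_disj)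

lemma block_start_less:
  "b < length ns \<Longrightarrow> u < ns ! b \<Longrightarrow> block_start ns b + u < sum_list ns"
  by (induction ns arbitrary: b) (auto simp: less_Suc_eq_0_disj)

lemma block_index_exhaust:
  assumes "k < sum_list ns"
  obtains b u where "b < length ns" "u < ns ! b" "k = block_start ns b + u"
  using assms
proof (induction ns arbitrary: k thesis)
  case (Cons n ns)
  show ?case
  proof (cases "k < n")
    case True
    thus ?thesis using Cons.prems(1)[of 0 k] by simp
  next
    case False
    hence "k - n < sum_list ns" using Cons.prems(2) by simp
    then obtain b u where "b < length ns" "u < ns ! b" "k - n = block_start ns b + u"
      using Cons.IH by blast
    thus ?thesis using Cons.prems(1)[of "Suc b" u] False by simp
  qed
qed simp

lemma sum_lessThan_blocks:
  fixes f :: "nat \<Rightarrow> 'b::comm_monoid_add"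
  shows "(\<Sum>k<sum_list ns. f k) = (\<Sum>b<length ns. \<Sum>u<ns ! b. f (block_start ns b + u))"
proof (induction ns arbitrary: f)
  case (Cons n ns)
  show ?case
    by (simp add: sum_lessThan_add Cons[of "\<lambda>k. f (n + k)"] sum.lessThan_Suc_shift add.assoc
        del: sum.lessThan_Suc)
qed simp

text \<open>Inverse to \<open>mat_block\<close> on blocks of fitting sizes: the family
  \<open>F\<close> is indexed from 1, which accounts for the \<open>Suc\<close>.\<close>

definition assemble :: "nat list \<Rightarrow> (nat \<Rightarrow> nat \<Rightarrow> 'a mat) \<Rightarrow> 'a mat" where
  "assemble ns F = mat (sum_list ns) (sum_list ns) (\<lambda>(i, j).
     F (Suc (fst (block_index ns i))) (Suc (fst (block_index ns j)))
       $$ (snd (block_index ns i), snd (block_index ns j)))"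

lemma assemble_carrier [simp]: "assemble ns F \<in> carrier_mat (sum_list ns) (sum_list ns)"
  by (simp add: assemble_def)

lemma mat_block_eq_block_start:
  "mat_block ns M (Suc i) (Suc j) =
    mat (ns ! i) (ns ! j) (\<lambda>(u, v). M $$ (block_start ns i + u, block_start ns j + v))"
  by (simp add: mat_block_def block_start_def)

lemma mat_block_assemble:
  assumes "1 \<le> i" "i \<le> length ns" "1 \<le> j" "j \<le> length ns"
    "F i j \<in> carrier_mat (ns ! (i - 1)) (ns ! (j - 1))"
  shows "mat_block ns (assemble ns F) i j = F i j"
proof -
  obtain b c where bc: "i = Suc b" "j = Suc c" "b < length ns" "c < length ns"
    using assms by (cases i; cases j) auto
  show ?thesis
    using assms(5) bc unfolding bc(1,2) mat_block_eq_block_start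
    by (intro eq_matI) (auto simp: assemble_def block_start_less block_index_block_start)
qed

text \<open>The system \<open>M v = 0\<close> is solved in the order of increasing rank: in block
  row \<open>b\<close>, the parts of \<open>v\<close> of lower rank vanish by induction, the other
  off-diagonal blocks vanish by \<open>zero\<close>, and the invertible diagonal block kills the
  part at \<open>b\<close>. The rank covers matrices that are triangular only after permuting the
  blocks.\<close>

lemma block_triangular_imp_GL:
  fixes M :: "'a::field mat" and rank :: "nat \<Rightarrow> nat"
  assumes M: "M \<in> carrier_mat (sum_list ns) (sum_list ns)"
    and diag: "\<And>b. b \<in> {1..length ns} \<Longrightarrow> mat_block ns M b b \<in> GL (ns ! (b - 1))"
    and zero: "\<And>b c. b \<in> {1..length ns} \<Longrightarrow> c \<in> {1..length ns} \<Longrightarrow> b \<noteq> c \<Longrightarrow> rank b \<le> rank c \<Longrightarrow>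
      mat_block ns M b c = 0\<^sub>m (ns ! (b - 1)) (ns ! (c - 1))"
  shows "M \<in> GL (sum_list ns)"
proof (rule GL_I_kernel[OF M])
  fix v :: "'a vec" assume v: "v \<in> carrier_vec (sum_list ns)" and Mv: "M *\<^sub>v v = 0\<^sub>v (sum_list ns)"
  have vanish: "\<forall>u<ns ! b. v $ (block_start ns b + u) = 0" if "b < length ns" for b
    using that
  proof (induction "rank (Suc b)" arbitrary: b rule: less_induct)
    case less
    let ?D = "mat_block ns M (Suc b) (Suc b)" and ?v = "vec (ns ! b) (\<lambda>u. v $ (block_start ns b + u))"
    have "?v = 0\<^sub>v (ns ! b)"
    proof (rule GL_kernel)
      show "?D \<in> GL (ns ! b)" using diag[of "Suc b"] less.prems by simp
      show "?D *\<^sub>v ?v = 0\<^sub>v (ns ! b)"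
      proof (rule eq_vecI)
        fix u assume "u < dim_vec (0\<^sub>v (ns ! b) :: 'a vec)"
        hence u: "u < ns ! b" by simp
        let ?k = "block_start ns b + u"
        have k: "?k < sum_list ns" using block_start_less less.prems u by blast
        let ?f = "\<lambda>c. \<Sum>t<ns ! c. M $$ (?k, block_start ns c + t) * v $ (block_start ns c + t)"
        have "0 = (M *\<^sub>v v) $ ?k" using k by (simp add: Mv)
        also have "\<dots> = (\<Sum>t<sum_list ns. M $$ (?k, t) * v $ t)"
          using k M v by (auto simp: scalar_prod_def lessThan_atLeast0)
        also have "\<dots> = (\<Sum>c<length ns. ?f c)" by (rule sum_lessThan_blocks)
        also have "\<dots> = (\<Sum>c<length ns. if c = b then ?f b else 0)"
        proof (intro sum.cong refl)
          fix c assume "c \<in> {..<length ns}"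
          hence c: "c < length ns" by simp
          have "?f c = 0" if "c \<noteq> b"
          proof (cases "rank (Suc c) < rank (Suc b)")
            case True
            thus ?thesis using less.hyps c by simp
          next
            case False
            hence z: "mat_block ns M (Suc b) (Suc c) = 0\<^sub>m (ns ! b) (ns ! c)"
              using zero[of "Suc b" "Suc c"] that c less.prems by simp
            have "M $$ (?k, block_start ns c + t) = 0" if "t < ns ! c" for t
              using arg_cong[OF z, of "\<lambda>X. X $$ (u, t)"] that u by (simp add: mat_block_eq_block_start)
            thus ?thesis by simp
          qed
          thus "?f c = (if c = b then ?f b else 0)" by simp
        qed
        also have "\<dots> = ?f b" using less.prems by simp
        also have "\<dots> = (?D *\<^sub>v ?v) $ u"
          using u by (auto simp: mat_block_eq_block_start scalar_prod_def lessThan_atLeast0)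
        finally show "(?D *\<^sub>v ?v) $ u = 0\<^sub>v (ns ! b) $ u" using u by simp
      qed (simp add: mat_block_eq_block_start)
    qed simp
    thus ?case by (metis index_vec index_zero_vec(1))
  qed
  show "v = 0\<^sub>v (sum_list ns)"
  proof (rule eq_vecI)
    fix k assume "k < dim_vec (0\<^sub>v (sum_list ns) :: 'a vec)"
    thus "v $ k = 0\<^sub>v (sum_list ns) $ k"
      using vanish by (auto elim!: block_index_exhaust)
  qed (use v in simp)
qed

section \<open>Rows and matrices cut into four blocks\<close>

definition sub_mat :: "nat \<Rightarrow> nat \<Rightarrow> nat \<Rightarrow> nat \<Rightarrow> 'a mat \<Rightarrow> 'a mat" where
  "sub_mat s d t e M = mat d e (\<lambda>(i, j). M $$ (s + i, t + j))"

lemma sub_mat_carrier [simp]: "sub_mat s d t e M \<in> carrier_mat d e"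
  by (simp add: sub_mat_def)

lemma sub_mat_transpose:
  "M \<in> carrier_mat n k \<Longrightarrow> s + d \<le> k \<Longrightarrow> t + e \<le> n \<Longrightarrow>
    sub_mat s d t e (transpose_mat M) = transpose_mat (sub_mat t e s d M)"
  by (auto simp: sub_mat_def intro!: eq_matI)

lemma sub_mat_smult:
  "M \<in> carrier_mat n k \<Longrightarrow> s + d \<le> n \<Longrightarrow> t + e \<le> k \<Longrightarrow>
    sub_mat s d t e (c \<cdot>\<^sub>m M) = c \<cdot>\<^sub>m sub_mat s d t e M"
  by (auto simp: sub_mat_def intro!: eq_matI)

text \<open>The part of the row \<open>(a, b, c, d) M\<close> lying in the \<open>e\<close> columns
  that start at \<open>t\<close>, with the rows of \<open>M\<close> cut into blocks of the sizes of
  \<open>a\<close>, \<open>b\<close>, \<open>c\<close>, \<open>d\<close>.\<close>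

definition row_times_blocks :: "nat \<Rightarrow> nat \<Rightarrow> nat \<Rightarrow> nat \<Rightarrow> 'a::field poly vec \<Rightarrow> 'a poly vec \<Rightarrow>
    'a poly vec \<Rightarrow> 'a poly vec \<Rightarrow> 'a mat \<Rightarrow> nat \<Rightarrow> nat \<Rightarrow> 'a poly vec" where
  "row_times_blocks n1 n2 n3 n4 a b c d M t e =
    row_times a (sub_mat 0 n1 t e M) + row_times b (sub_mat n1 n2 t e M) +
    row_times c (sub_mat (n1 + n2) n3 t e M) + row_times d (sub_mat (n1 + n2 + n3) n4 t e M)"

lemma row_times_blocks_carrier [simp]: "row_times_blocks n1 n2 n3 n4 a b c d M t e \<in> carrier_vec e"
  unfolding row_times_blocks_def
  by (intro add_carrier_vec row_times_carrier[OF sub_mat_carrier])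

lemma index_row_times_append:
  assumes "a \<in> carrier_vec n1" "b \<in> carrier_vec n2" "c \<in> carrier_vec n3" "d \<in> carrier_vec n4"
    and M: "M \<in> carrier_mat (n1 + n2 + n3 + n4) k" and "t + e \<le> k" "j < e"
  shows "row_times (a @\<^sub>v b @\<^sub>v c @\<^sub>v d) M $ (t + j) = row_times_blocks n1 n2 n3 n4 a b c d M t e $ j"
proof -
  have v: "a @\<^sub>v b @\<^sub>v c @\<^sub>v d \<in> carrier_vec (n1 + n2 + n3 + n4)"
    using assms by (auto intro!: carrier_vecI)
  have dims: "dim_vec a = n1" "dim_vec b = n2" "dim_vec c = n3" "dim_vec d = n4" using assms by auto
  have i: "row_times x (sub_mat s n t e M) $ j = (\<Sum>i<n. smult (M $$ (s + i, t + j)) (x $ i))"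
    if "x \<in> carrier_vec n" for x s n
    using \<open>j < e\<close> by (subst index_row_times[OF sub_mat_carrier that]) (auto simp: sub_mat_def)
  have "row_times (a @\<^sub>v b @\<^sub>v c @\<^sub>v d) M $ (t + j) =
      (\<Sum>i<n1 + n2 + n3 + n4. smult (M $$ (i, t + j)) ((a @\<^sub>v b @\<^sub>v c @\<^sub>v d) $ i))"
    using assms by (intro index_row_times[OF M v]) simp
  also have "\<dots> = (\<Sum>i<n1. smult (M $$ (0 + i, t + j)) (a $ i)) + (\<Sum>i<n2. smult (M $$ (n1 + i, t + j)) (b $ i))
      + (\<Sum>i<n3. smult (M $$ (n1 + n2 + i, t + j)) (c $ i)) + (\<Sum>i<n4. smult (M $$ (n1 + n2 + n3 + i, t + j)) (d $ i))"
    unfolding sum_lessThan_add by (simp add: dims)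
  also have "\<dots> = row_times_blocks n1 n2 n3 n4 a b c d M t e $ j"
    unfolding row_times_blocks_def i[OF assms(1), symmetric] i[OF assms(2), symmetric]
      i[OF assms(3), symmetric] i[OF assms(4), symmetric]
    using \<open>j < e\<close> by (simp add: sub_mat_def)
  finally show ?thesis .
qed

lemma row_times_append:
  assumes "a \<in> carrier_vec n1" "b \<in> carrier_vec n2" "c \<in> carrier_vec n3" "d \<in> carrier_vec n4"
    and M: "M \<in> carrier_mat (n1 + n2 + n3 + n4) (n1 + n2 + n3 + n4)"
  shows "row_times (a @\<^sub>v b @\<^sub>v c @\<^sub>v d) M =
    row_times_blocks n1 n2 n3 n4 a b c d M 0 n1 @\<^sub>v
    row_times_blocks n1 n2 n3 n4 a b c d M n1 n2 @\<^sub>v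
    row_times_blocks n1 n2 n3 n4 a b c d M (n1 + n2) n3 @\<^sub>v
    row_times_blocks n1 n2 n3 n4 a b c d M (n1 + n2 + n3) n4" (is "?l = ?r0 @\<^sub>v ?r1 @\<^sub>v ?r2 @\<^sub>v ?r3")
proof (rule eq_vecI)
  note idx = index_row_times_append[OF assms]
  note dims = carrier_vecD[OF row_times_blocks_carrier]
  fix i assume "i < dim_vec (?r0 @\<^sub>v ?r1 @\<^sub>v ?r2 @\<^sub>v ?r3)"
  hence i: "i < n1 + n2 + n3 + n4" by (simp add: dims)
  consider "i < n1" | j where "i = n1 + j" "j < n2" | j where "i = n1 + n2 + j" "j < n3"
    | j where "i = n1 + n2 + n3 + j" "j < n4"
  proof -
    assume *: "i < n1 \<Longrightarrow> thesis" "\<And>j. i = n1 + j \<Longrightarrow> j < n2 \<Longrightarrow> thesis"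
      "\<And>j. i = n1 + n2 + j \<Longrightarrow> j < n3 \<Longrightarrow> thesis" "\<And>j. i = n1 + n2 + n3 + j \<Longrightarrow> j < n4 \<Longrightarrow> thesis"
    show thesis
      using i *(1) *(2)[of "i - n1"] *(3)[of "i - (n1 + n2)"] *(4)[of "i - (n1 + n2 + n3)"] by linarith
  qed
  thus "?l $ i = (?r0 @\<^sub>v ?r1 @\<^sub>v ?r2 @\<^sub>v ?r3) $ i"
    by cases (use idx[of 0 n1 i] idx[of n1 n2] idx[of "n1 + n2" n3] idx[of "n1 + n2 + n3" n4]
      in \<open>auto simp: dims\<close>)
qed (use M in \<open>auto simp: carrier_vecD[OF row_times_blocks_carrier]\<close>)

subsection \<open>The group and the equivalence\<close>

text \<open>The shape of the first row \<open>u\<close>, whose last two parts are zero; the last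
  column \<open>w\<close>, treated next, has zero second and fourth parts.\<close>

lemma row_times_blocks_u:
  assumes "a \<in> carrier_vec n1" "b \<in> carrier_vec n2"
  shows "row_times_blocks n1 n2 n3 n4 a b (0\<^sub>v n3) (0\<^sub>v n4) M t e =
    row_times a (sub_mat 0 n1 t e M) + row_times b (sub_mat n1 n2 t e M)"
  unfolding row_times_blocks_def zero_row_times[OF sub_mat_carrier]
  by (intro eq_vecI) (simp_all add: sub_mat_def)

lemma row_times_blocks_w:
  assumes "a \<in> carrier_vec n1" "c \<in> carrier_vec n3"
  shows "row_times_blocks n1 n2 n3 n4 a (0\<^sub>v n2) c (0\<^sub>v n4) M t e =
    row_times a (sub_mat 0 n1 t e M) + row_times c (sub_mat (n1 + n2) n3 t e M)"
  unfolding row_times_blocks_def zero_row_times[OF sub_mat_carrier]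
  by (intro eq_vecI) (simp_all add: sub_mat_def)

lemma append_four_eqD:
  assumes "a @\<^sub>v b @\<^sub>v c @\<^sub>v d = a' @\<^sub>v b' @\<^sub>v c' @\<^sub>v d'"
    and "a \<in> carrier_vec n1" "b \<in> carrier_vec n2" "c \<in> carrier_vec n3"
    and "a' \<in> carrier_vec n1" "b' \<in> carrier_vec n2" "c' \<in> carrier_vec n3"
  shows "a = a'" "b = b'" "c = c'"
  using assms append_vec_eq[of a n1 a'] append_vec_eq[of b n2 b'] append_vec_eq[of c n3 c'] by blast+

section \<open>Elements of the group and their diagonal blocks\<close>

lemma GL_factors:
  assumes M: "M \<in> carrier_mat n n" and N: "N \<in> carrier_mat n n" and MN: "M * N \<in> GL n"
  shows "M \<in> GL n" "N \<in> GL n"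
  using MN by (auto simp: GL_iff_det det_mult[OF M N] M N)

lemma sum_list_G_sizes: "r1 \<le> l \<Longrightarrow> sum_list (G_sizes l r1 r2) = l + r1 + r2 + 1"
  by (simp add: G_sizes_def)

text \<open>The relation \<open>g11 g22^T = c I\<close> with nonzero \<open>c\<close> makes
  \<open>g11\<close> and \<open>g22\<close> invertible, so the assembled matrix is block upper
  triangular with invertible diagonal blocks.\<close>

lemma G_group_from_blocks:
  fixes g11 g22 g33 g44 :: "'a::field mat"
  assumes r1: "r1 \<le> l"
    and g11: "g11 \<in> carrier_mat r1 r1" and g22: "g22 \<in> carrier_mat r1 r1"
    and g23: "g23 \<in> carrier_mat r1 (l - r1)" and g24: "g24 \<in> carrier_mat r1 r2"
    and g25: "g25 \<in> carrier_mat r1 1" and g33: "g33 \<in> GL (l - r1)"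
    and g35: "g35 \<in> carrier_mat (l - r1) 1" and g44: "g44 \<in> GL r2" and g45: "g45 \<in> carrier_mat r2 1"
    and c: "c \<noteq> 0" and g1122: "g11 * transpose_mat g22 = c \<cdot>\<^sub>m 1\<^sub>m r1"
  obtains g where "g \<in> G_group l r1 r2"
    "mat_block (G_sizes l r1 r2) g 1 1 = g11" "mat_block (G_sizes l r1 r2) g 2 2 = g22"
    "mat_block (G_sizes l r1 r2) g 2 3 = g23" "mat_block (G_sizes l r1 r2) g 2 4 = g24"
    "mat_block (G_sizes l r1 r2) g 2 5 = g25" "mat_block (G_sizes l r1 r2) g 3 3 = g33"
    "mat_block (G_sizes l r1 r2) g 3 5 = g35" "mat_block (G_sizes l r1 r2) g 4 4 = g44"
    "mat_block (G_sizes l r1 r2) g 4 5 = g45" "mat_block (G_sizes l r1 r2) g 5 5 $$ (0, 0) = c"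
proof -
  let ?ns = "G_sizes l r1 r2"
  define F where "F i j = (if (i, j) = (1, 1) then g11 else if (i, j) = (2, 2) then g22
    else if (i, j) = (2, 3) then g23 else if (i, j) = (2, 4) then g24 else if (i, j) = (2, 5) then g25
    else if (i, j) = (3, 3) then g33 else if (i, j) = (3, 5) then g35 else if (i, j) = (4, 4) then g44
    else if (i, j) = (4, 5) then g45 else if (i, j) = (5, 5) then mat 1 1 (\<lambda>_. c)
    else 0\<^sub>m (?ns ! (i - 1)) (?ns ! (j - 1)))" for i j :: nat
  define g where "g = assemble ?ns F"
  have len: "length ?ns = 5" by (simp add: G_sizes_def)
  have ns: "?ns ! 0 = r1" "?ns ! 1 = r1" "?ns ! 2 = l - r1" "?ns ! 3 = r2" "?ns ! 4 = 1"
    by (simp_all add: G_sizes_def)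
  have Fc: "F i j \<in> carrier_mat (?ns ! (i - 1)) (?ns ! (j - 1))" for i j
    using ns g11 g22 g23 g24 g25 GL_carrier[OF g33] g35 GL_carrier[OF g44] g45
    by (simp add: F_def)
  have blk: "mat_block ?ns g i j = F i j" if "i \<in> {1..5}" "j \<in> {1..5}" for i j
    unfolding g_def using that by (intro mat_block_assemble Fc) (auto simp: len)
  have "g11 * transpose_mat g22 \<in> GL r1"
    unfolding g1122 using c by (intro GL_smult) (auto simp: GL_iff_det)
  hence GL12: "g11 \<in> GL r1" "g22 \<in> GL r1"
    using GL_factors[OF g11, of "transpose_mat g22"] g22 GL_transpose[of "transpose_mat g22" r1] by auto
  have "mat 1 1 (\<lambda>_. c) \<in> GL 1" using c by (simp add: GL_iff_det det_single)
  hence F_diag: "F b b \<in> GL (?ns ! (b - 1))" if "b \<in> {1..5}" for b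
  proof -
    assume *: "mat 1 1 (\<lambda>_. c) \<in> GL 1"
    have "b = 1 \<or> b = 2 \<or> b = 3 \<or> b = 4 \<or> b = 5" using that by auto
    thus ?thesis using * GL12 g33 g44 ns by (elim disjE) (simp_all add: F_def)
  qed
  have F_zero: "F i j = 0\<^sub>m (?ns ! (i - 1)) (?ns ! (j - 1))"
    if "i \<noteq> j" "(i, j) \<notin> {(2, 3), (2, 4), (2, 5), (3, 5), (4, 5)}" for i j
    using that by (auto simp: F_def)
  \<comment> \<open>Upper triangular systems are solved from the last block upwards, hence the
    reversed rank.\<close>
  have "g \<in> GL (sum_list ?ns)"
  proof (rule block_triangular_imp_GL[where rank = "\<lambda>b. 5 - b"])
    show "g \<in> carrier_mat (sum_list ?ns) (sum_list ?ns)" by (simp add: g_def)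
    show "mat_block ?ns g b b \<in> GL (?ns ! (b - 1))" if "b \<in> {1..length ?ns}" for b
      using that F_diag by (simp add: blk len)
    show "mat_block ?ns g b d = 0\<^sub>m (?ns ! (b - 1)) (?ns ! (d - 1))"
      if "b \<in> {1..length ?ns}" "d \<in> {1..length ?ns}" "b \<noteq> d" "5 - b \<le> 5 - d" for b d
    proof -
      have "(b, d) \<notin> {(2, 3), (2, 4), (2, 5), (3, 5), (4, 5)}" using that by (auto simp: len)
      thus ?thesis using that F_zero[of b d] by (simp add: blk len)
    qed
  qed
  hence "g \<in> G_group l r1 r2"
    unfolding G_group_def Let_def using F_zero g1122 sum_list_G_sizes[OF r1, of r2]
    by (simp add: blk) (simp add: F_def)
  thus thesis
    by (rule that) (simp_all add: blk, simp_all add: F_def)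
qed

text \<open>The last row of \<open>g\<close> is zero outside its last block, so \<open>c = 0\<close>
  would give an invertible matrix a zero row.\<close>

lemma G_group_diag_blocks:
  assumes r1: "r1 \<le> l" and g: "g \<in> G_group l r1 r2"
  defines "c \<equiv> mat_block (G_sizes l r1 r2) g 5 5 $$ (0, 0)"
  shows "c \<noteq> 0"
    and "mat_block (G_sizes l r1 r2) g 1 1 * transpose_mat (mat_block (G_sizes l r1 r2) g 2 2) = c \<cdot>\<^sub>m 1\<^sub>m r1"
proof -
  let ?ns = "G_sizes l r1 r2"
  show "mat_block ?ns g 1 1 * transpose_mat (mat_block ?ns g 2 2) = c \<cdot>\<^sub>m 1\<^sub>m r1"
    using g by (simp add: G_group_def Let_def c_def)
  have zero: "mat_block ?ns g 5 j = 0\<^sub>m (?ns ! 4) (?ns ! (j - 1))" if "1 \<le> j" "j \<le> 4" for j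
    using g that unfolding G_group_def Let_def by auto
  have len: "length ?ns = 5" by (simp add: G_sizes_def)
  have s4: "?ns ! 4 = 1" by (simp add: G_sizes_def)
  have GL: "g \<in> GL (sum_list ?ns)" using g sum_list_G_sizes[OF r1, of r2] by (simp add: G_group_def)
  have "block_start ?ns 4 + 0 < sum_list ?ns" by (rule block_start_less) (simp_all add: len s4)
  then obtain k where k: "k < sum_list ?ns" and nz: "g $$ (block_start ?ns 4, k) \<noteq> 0"
    using GL_row_neq_zero[OF GL, of "block_start ?ns 4"] by auto
  obtain b u where b: "b < 5" "u < ?ns ! b" "k = block_start ?ns b + u"
    using block_index_exhaust[OF k] len by metis
  have entry: "g $$ (block_start ?ns 4, k) = mat_block ?ns g 5 (Suc b) $$ (0, u)"
    using b s4 mat_block_eq_block_start[of ?ns g 4 b] by (simp add: numeral_eq_Suc)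
  have "b = 4"
  proof (rule ccontr)
    assume "b \<noteq> 4"
    hence "mat_block ?ns g 5 (Suc b) = 0\<^sub>m (?ns ! 4) (?ns ! b)" using zero[of "Suc b"] b by simp
    thus False using nz entry b s4 by simp
  qed
  thus "c \<noteq> 0" using nz entry b s4 by (simp add: c_def)
qed

section \<open>The two directions of the equivalence\<close>

lemma smult_mat_eq_zeroD:
  "M \<in> carrier_mat n k \<Longrightarrow> c \<cdot>\<^sub>m M = 0\<^sub>m n k \<Longrightarrow> (c :: 'a::field) \<noteq> 0 \<Longrightarrow> M = 0\<^sub>m n k"
  by (auto simp: mat_eq_iff)

text \<open>The zero parts of \<open>u'\<close> and \<open>w\<close> annihilate the blocks of
  \<open>Q\<close> and \<open>R\<close> that would mix the data. What remains gives
  \<open>g22\<close>, \<open>g23\<close>, \<open>g33\<close> from \<open>Q\<close>, and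
  \<open>g11\<close>, \<open>g44\<close> as inverses of blocks of \<open>R\<close>;
  \<open>g24\<close> and the last column come from solving for \<open>\<beta>2\<close> and
  \<open>\<beta>\<close>.\<close>

lemma equivalent_imp_star:
  fixes a1 a2 \<alpha>2 b1 b2 \<beta>2 :: "'a::field poly vec"
  assumes r1: "1 \<le> r1" "r1 \<le> l" and r2: "l + r2 \<le> m"
    and a1: "a1 \<in> carrier_vec r1" and a2: "a2 \<in> carrier_vec (l - r1)" and \<alpha>2: "\<alpha>2 \<in> carrier_vec r2"
    and b1: "b1 \<in> carrier_vec r1" and b2: "b2 \<in> carrier_vec (l - r1)" and \<beta>2: "\<beta>2 \<in> carrier_vec r2"
    and S: "S \<in> GLss r1" and S': "S' \<in> GLss r1"
    and ind_a: "lin_indep_entries (a1 @\<^sub>v a2)" and ind_\<alpha>: "lin_indep_entries (a1 @\<^sub>v \<alpha>2)"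
    and ind_b: "lin_indep_entries (b1 @\<^sub>v b2)" and ind_\<beta>: "lin_indep_entries (b1 @\<^sub>v \<beta>2)"
    and eqv: "equivalent_mats (m + 2)
      (bordered_mat m (a1 @\<^sub>v a2 @\<^sub>v 0\<^sub>v r2 @\<^sub>v 0\<^sub>v (m - l - r2))
        (row_times a1 S @\<^sub>v 0\<^sub>v (l - r1) @\<^sub>v \<alpha>2 @\<^sub>v 0\<^sub>v (m - l - r2)) (\<alpha> + quad a1 S))
      (bordered_mat m (b1 @\<^sub>v b2 @\<^sub>v 0\<^sub>v r2 @\<^sub>v 0\<^sub>v (m - l - r2))
        (row_times b1 S' @\<^sub>v 0\<^sub>v (l - r1) @\<^sub>v \<beta>2 @\<^sub>v 0\<^sub>v (m - l - r2)) (\<beta> + quad b1 S'))"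
  shows "\<exists>g\<in>G_group l r1 r2. (S', b1, b2, \<beta>2, \<beta>) = star l r1 r2 (S, a1, a2, \<alpha>2, \<alpha>) g"
proof -
  define n2 where "n2 = l - r1"
  define n4 where "n4 = m - l - r2"
  have m: "r1 + n2 + r2 + n4 = m" using r1 r2 by (simp add: n2_def n4_def)
  note a2 = a2[folded n2_def] and b2 = b2[folded n2_def]
  have SGL: "S \<in> GL r1" "S' \<in> GL r1" using S S' by (auto simp: GLss_def)
  note Sc = SGL[THEN GL_carrier]
  have row_c: "row_times x M \<in> carrier_vec k" if "M \<in> carrier_mat n k" for x and M :: "'a mat" and n k
    using that by simp
  \<comment> \<open>The first entry of \<open>x M\<close> combines the entries of \<open>x\<close>
    with the first column of \<open>M\<close> as coefficients. The cases \<open>M = 1\<close> and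
    \<open>M = S\<close> give the nonzero entries of \<open>u'\<close> and \<open>w\<close> required
    for the elimination.\<close>
  have nz: "row_times x M $ 0 \<noteq> 0"
    if x: "x \<in> carrier_vec r1" and y: "y \<in> carrier_vec k" and xy: "lin_indep_entries (x @\<^sub>v y)" and M: "M \<in> GL r1"
    for x y :: "'a poly vec" and M k
  proof
    assume 0: "row_times x M $ 0 = 0"
    note Mc = GL_carrier[OF M]
    let ?C = "sub_mat 0 r1 0 1 M"
    have "row_times x ?C = 0\<^sub>v 1"
    proof (rule eq_vecI)
      fix j assume "j < dim_vec (0\<^sub>v 1 :: 'a poly vec)"
      hence j: "j = 0" by simp
      have "row_times x ?C $ 0 = (\<Sum>i<r1. smult (M $$ (i, 0)) (x $ i))"
        by (subst index_row_times[OF sub_mat_carrier x]) (auto simp: sub_mat_def)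
      also have "\<dots> = 0" using 0 r1 index_row_times[OF Mc x, of 0] by simp
      finally show "row_times x ?C $ j = 0\<^sub>v 1 $ j" by (simp add: j)
    qed (simp add: sub_mat_def)
    hence "?C = 0\<^sub>m r1 1" using lin_indep_append_left[OF xy x y sub_mat_carrier] by blast
    hence "M $$ (i, 0) = 0" if "i < r1" for i
      using that by (simp add: sub_mat_def mat_eq_iff)
    thus False using GL_column_neq_zero[OF M, of 0] r1 by auto
  qed
  let ?u = "a1 @\<^sub>v a2 @\<^sub>v 0\<^sub>v r2 @\<^sub>v 0\<^sub>v n4" and ?u' = "b1 @\<^sub>v b2 @\<^sub>v 0\<^sub>v r2 @\<^sub>v 0\<^sub>v n4"
  let ?w = "row_times a1 S @\<^sub>v 0\<^sub>v n2 @\<^sub>v \<alpha>2 @\<^sub>v 0\<^sub>v n4" and ?w' = "row_times b1 S' @\<^sub>v 0\<^sub>v n2 @\<^sub>v \<beta>2 @\<^sub>v 0\<^sub>v n4"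
  have aS: "row_times a1 S \<in> carrier_vec r1" and bS: "row_times b1 S' \<in> carrier_vec r1"
    using Sc by auto
  have carr: "?u \<in> carrier_vec m" "?w \<in> carrier_vec m" "?u' \<in> carrier_vec m" "?w' \<in> carrier_vec m"
    using a1 a2 b1 b2 \<alpha>2 \<beta>2 carrier_matD(2)[OF Sc(1)] carrier_matD(2)[OF Sc(2)] m
    by (auto intro!: carrier_vecI)
  have u'0: "?u' $ 0 \<noteq> 0"
    using nz[OF b1 b2 ind_b[unfolded n2_def], of "1\<^sub>m r1"] b1 r1 by (simp add: GL_iff_det)
  have w0: "?w $ 0 \<noteq> 0"
    using nz[OF a1 a2 ind_a[unfolded n2_def] SGL(1)] r1 carrier_vecD[OF aS] by simp
  have ind_u: "k 0 = 0" if sum0: "(\<Sum>i<m. smult (k i) (?u $ i)) = 0" for k :: "nat \<Rightarrow> 'a"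
  proof -
    have d: "dim_vec a1 = r1" "dim_vec a2 = n2" using a1 a2 by auto
    have "(\<Sum>i<dim_vec (a1 @\<^sub>v a2). smult (k i) ((a1 @\<^sub>v a2) $ i)) = 0"
      using sum0 unfolding m[symmetric] sum_lessThan_add index_append_vec(2) d by (simp add: d)
    thus ?thesis using ind_a r1 d unfolding lin_indep_entries_def by auto
  qed
  have m1: "1 \<le> m" using r1 r2 by simp
  obtain c Q R X Y where c: "c \<noteq> 0" and Q: "Q \<in> carrier_mat m m" and R: "R \<in> carrier_mat m m"
    and X: "X \<in> carrier_mat m 1" and Y: "Y \<in> carrier_mat m 1" and cR: "c \<cdot>\<^sub>m R = transpose_mat Q"
    and uQ: "row_times ?u Q = ?u'" and wR: "row_times ?w' R = ?w"
    and \<phi>: "\<beta> + quad b1 S' = smult c (\<alpha> + quad a1 S) + row_times ?u X $ 0 - row_times ?w' Y $ 0"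
    by (rule equivalent_bordered_matD[OF m1 carr u'0 w0 _ eqv[folded n2_def n4_def]])
      (erule ind_u, rule that)
  let ?t3 = "r1 + n2"
  \<comment> \<open>Numbering by the partition \<open>r1, n2, r2, n4\<close>. Of \<open>Q\<close>
    the rows meeting the nonzero parts of \<open>u\<close> are named (first and second), of
    \<open>R\<close> those meeting the nonzero parts of \<open>w'\<close> (first and third).\<close>
  define q11 where "q11 = sub_mat 0 r1 0 r1 Q"
  define q12 where "q12 = sub_mat 0 r1 r1 n2 Q"
  define q13 where "q13 = sub_mat 0 r1 ?t3 r2 Q"
  define q21 where "q21 = sub_mat r1 n2 0 r1 Q"
  define q22 where "q22 = sub_mat r1 n2 r1 n2 Q"
  define q23 where "q23 = sub_mat r1 n2 ?t3 r2 Q"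
  define r11 where "r11 = sub_mat 0 r1 0 r1 R"
  define r12 where "r12 = sub_mat 0 r1 r1 n2 R"
  define r13 where "r13 = sub_mat 0 r1 ?t3 r2 R"
  define r31 where "r31 = sub_mat ?t3 r2 0 r1 R"
  define r32 where "r32 = sub_mat ?t3 r2 r1 n2 R"
  define r33 where "r33 = sub_mat ?t3 r2 ?t3 r2 R"
  note defs = q11_def q12_def q13_def q21_def q22_def q23_def r11_def r12_def r13_def r31_def r32_def r33_def
  have bc: "q11 \<in> carrier_mat r1 r1" "q12 \<in> carrier_mat r1 n2" "q13 \<in> carrier_mat r1 r2"
    "q21 \<in> carrier_mat n2 r1" "q22 \<in> carrier_mat n2 n2" "q23 \<in> carrier_mat n2 r2"
    "r11 \<in> carrier_mat r1 r1" "r12 \<in> carrier_mat r1 n2" "r13 \<in> carrier_mat r1 r2"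
    "r31 \<in> carrier_mat r2 r1" "r32 \<in> carrier_mat r2 n2" "r33 \<in> carrier_mat r2 r2"
    by (simp_all add: defs)
  have Qm: "Q \<in> carrier_mat (r1 + n2 + r2 + n4) (r1 + n2 + r2 + n4)"
    and Rm: "R \<in> carrier_mat (r1 + n2 + r2 + n4) (r1 + n2 + r2 + n4)" using Q R by (simp_all add: m)
  \<comment> \<open>Carries information between a block of \<open>R\<close> and the opposite block
    of \<open>Q\<close>.\<close>
  have transp: "c \<cdot>\<^sub>m sub_mat s d t e R = transpose_mat (sub_mat t e s d Q)" if "s + d \<le> m" "t + e \<le> m" for s d t e
    using that Q R by (simp flip: sub_mat_smult[OF R] sub_mat_transpose[OF Q] cR)
  note uQ' = uQ[unfolded row_times_append[OF a1 a2 zero_carrier_vec zero_carrier_vec Qm]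
      row_times_blocks_u[OF a1 a2]]
  have sum_c: "row_times x M + row_times y N \<in> carrier_vec k"
    if "M \<in> carrier_mat i k" "N \<in> carrier_mat j k" for x y :: "'a poly vec" and M N :: "'a mat" and i j k
    by (rule add_carrier_vec[OF row_c[OF that(1)] row_c[OF that(2)]])
  have eq_u: "row_times a1 q11 + row_times a2 q21 = b1" "row_times a1 q12 + row_times a2 q22 = b2"
    "row_times a1 q13 + row_times a2 q23 = 0\<^sub>v r2"
    using append_four_eqD[OF uQ', of r1 n2 r2] b1 b2
    unfolding defs by (simp_all add: sum_c[OF sub_mat_carrier sub_mat_carrier])
  note wR' = wR[unfolded row_times_append[OF bS zero_carrier_vec \<beta>2 zero_carrier_vec Rm]
      row_times_blocks_w[OF bS \<beta>2]]
  have eq_w: "row_times (row_times b1 S') r11 + row_times \<beta>2 r31 = row_times a1 S"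
    "row_times (row_times b1 S') r12 + row_times \<beta>2 r32 = 0\<^sub>v n2"
    "row_times (row_times b1 S') r13 + row_times \<beta>2 r33 = \<alpha>2"
    using append_four_eqD[OF wR', of r1 n2 r2] aS \<alpha>2
    unfolding defs by (simp_all add: sum_c[OF sub_mat_carrier sub_mat_carrier])
  \<comment> \<open>The third part of \<open>u'\<close> is zero and the entries of \<open>a1\<close>
    and \<open>a2\<close> are independent.\<close>
  have "q13 = 0\<^sub>m r1 r2" using lin_indep_appendD(1)[OF ind_a a1 a2 bc(3,6) eq_u(3)] .
  hence "c \<cdot>\<^sub>m r31 = 0\<^sub>m r2 r1"
    using transp[of ?t3 r2 0 r1] m by (simp add: r31_def q13_def)
  hence r31: "r31 = 0\<^sub>m r2 r1" by (rule smult_mat_eq_zeroD[OF bc(10) _ c])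
  have "row_times b1 (S' * r12) + row_times \<beta>2 r32 = 0\<^sub>v n2"
    using eq_w(2) by (simp add: row_times_mult[OF Sc(2) bc(8) b1])
  \<comment> \<open>The second part of \<open>w\<close> is zero; now the independence of
    \<open>b1\<close> and \<open>\<beta>2\<close> is what counts, and then \<open>S'\<close> is
    cancelled.\<close>
  hence "S' * r12 = 0\<^sub>m r1 n2"
    by (intro lin_indep_appendD(1)[OF ind_\<beta> b1 \<beta>2 _ bc(11)] mult_carrier_mat[OF Sc(2) bc(8)])
  hence "r12 = 0\<^sub>m r1 n2"
    using mat_inv_mult_cancel_left[OF SGL(2) bc(8)] mat_inv_carrier[OF SGL(2)] by simp
  hence "transpose_mat q21 = 0\<^sub>m r1 n2"
    using transp[of 0 r1 r1 n2] m by (simp add: r12_def q21_def)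
  hence q21: "q21 = 0\<^sub>m n2 r1" by (metis transpose_transpose zero_transpose_mat)
  have cr11: "c \<cdot>\<^sub>m r11 = transpose_mat q11"
    using transp[of 0 r1 0 r1] m by (simp add: r11_def q11_def)
  have e1: "b1 = row_times a1 q11"
    using eq_u(1) a2 row_c[OF bc(1), of a1] by (simp add: q21)
  have e2: "b2 = row_times a1 q12 + row_times a2 q22" using eq_u(2) by simp
  have Sr11: "S' * r11 \<in> carrier_mat r1 r1" and Sr13: "S' * r13 \<in> carrier_mat r1 r2"
    using mult_carrier_mat[OF Sc(2)] bc by auto
  have "row_times b1 (S' * r11) = row_times a1 S"
    using eq_w(1) \<beta>2 row_c[OF Sr11, of b1] row_times_mult[OF Sc(2) bc(7) b1] by (simp add: r31)
  hence "row_times a1 (q11 * (S' * r11)) = row_times a1 S"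
    by (simp add: e1 row_times_mult[OF bc(1) Sr11 a1])
  \<comment> \<open>The independent row \<open>a1\<close> is cancelled. Besides relating
    \<open>S\<close> and \<open>S'\<close>, this exhibits the invertible \<open>S\<close> as a
    product with factors \<open>q11\<close> and \<open>r11\<close>, which are therefore
    invertible.\<close>
  hence core: "q11 * (S' * r11) = S"
    by (intro lin_indep_append_cancel[OF ind_a a1 a2 _ Sc(1)] mult_carrier_mat[OF bc(1) Sr11])
  have q11_GL: "q11 \<in> GL r1" and "S' * r11 \<in> GL r1"
    using GL_factors[OF bc(1) Sr11] core SGL(1) by auto
  hence r11_GL: "r11 \<in> GL r1" using GL_factors[OF Sc(2) bc(7)] by auto
  have q22_GL: "q22 \<in> GL n2"
    by (rule lin_indep_imp_GL[OF ind_b a1 a2 q11_GL bc(2) bc(5) e1 e2])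
  define i11 where "i11 = mat_inv r1 q11"
  have i11: "i11 \<in> GL r1" and q11_i11: "q11 * i11 = 1\<^sub>m r1" and i11_q11: "i11 * q11 = 1\<^sub>m r1"
    using mat_inv_GL[OF q11_GL] mat_inv_right[OF q11_GL] mat_inv_left[OF q11_GL] by (simp_all add: i11_def)
  have a1_b1: "a1 = row_times b1 i11"
    using row_times_mult[OF bc(1) GL_carrier[OF i11] a1] a1 by (simp add: e1 q11_i11)
  have e3: "\<alpha>2 = row_times b1 (S' * r13) + row_times \<beta>2 r33"
    using eq_w(3) by (simp add: row_times_mult[OF Sc(2) bc(9) b1])
  \<comment> \<open>The roles of the two data are exchanged: \<open>a1\<close> and
    \<open>\<alpha>2\<close> are expressed through \<open>b1\<close> and
    \<open>\<beta>2\<close>.\<close>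
  have r33_GL: "r33 \<in> GL r2"
    by (rule lin_indep_imp_GL[OF ind_\<alpha> b1 \<beta>2 i11 Sr13 bc(12) a1_b1 e3])
  define g11 where "g11 = mat_inv r1 r11"
  define g44 where "g44 = mat_inv r2 r33"
  have g11c: "g11 \<in> carrier_mat r1 r1" and g11_r11: "g11 * r11 = 1\<^sub>m r1" and r11_g11: "r11 * g11 = 1\<^sub>m r1"
    using mat_inv_props[OF r11_GL] by (simp_all add: g11_def)
  have g44_GL: "g44 \<in> GL r2" and g44c: "g44 \<in> carrier_mat r2 r2" and r33_g44: "r33 * g44 = 1\<^sub>m r2"
    using mat_inv_GL[OF r33_GL] mat_inv_props[OF r33_GL] by (simp_all add: g44_def)
  define x1 where "x1 = sub_mat 0 r1 0 1 X"
  define x2 where "x2 = sub_mat r1 n2 0 1 X"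
  define y1 where "y1 = sub_mat 0 r1 0 1 Y"
  define y3 where "y3 = sub_mat ?t3 r2 0 1 Y"
  have xc: "x1 \<in> carrier_mat r1 1" "x2 \<in> carrier_mat n2 1" "y1 \<in> carrier_mat r1 1" "y3 \<in> carrier_mat r2 1"
    by (simp_all add: x1_def x2_def y1_def y3_def)
  \<comment> \<open>Solving \<open>\<alpha>2 = b1 S' r13 + \<beta>2 r33\<close> for
    \<open>\<beta>2\<close>, with \<open>b1 = a1 q11\<close>, yields this block. Inserting the
    result into the terms of \<open>X\<close> and \<open>Y\<close> and collecting the coefficients
    of \<open>a1\<close> and \<open>\<alpha>2\<close> yields \<open>g25\<close> and
    \<open>g45\<close>.\<close>
  define g24 where "g24 = - (q11 * (S' * r13) * g44)"
  define g25 where "g25 = x1 - q11 * (S' * y1) - g24 * y3"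
  define g45 where "g45 = - (g44 * y3)"
  have p1: "q11 * (S' * r13) \<in> carrier_mat r1 r2" by (rule mult_carrier_mat[OF bc(1) Sr13])
  have p2: "q11 * (S' * r13) * g44 \<in> carrier_mat r1 r2" by (rule mult_carrier_mat[OF p1 g44c])
  have g24c: "g24 \<in> carrier_mat r1 r2" using p2 by (simp add: g24_def)
  have p3: "S' * y1 \<in> carrier_mat r1 1" by (rule mult_carrier_mat[OF Sc(2) xc(3)])
  have p4: "q11 * (S' * y1) \<in> carrier_mat r1 1" by (rule mult_carrier_mat[OF bc(1) p3])
  have p5: "g24 * y3 \<in> carrier_mat r1 1" by (rule mult_carrier_mat[OF g24c xc(4)])
  have p6: "g44 * y3 \<in> carrier_mat r2 1" by (rule mult_carrier_mat[OF g44c xc(4)])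
  have p7: "x1 - q11 * (S' * y1) \<in> carrier_mat r1 1" by (rule minus_carrier_mat[OF p4])
  have g25c: "g25 \<in> carrier_mat r1 1" unfolding g25_def by (rule minus_carrier_mat[OF p5])
  have g45c: "g45 \<in> carrier_mat r2 1" using p6 by (simp add: g45_def)
  \<comment> \<open>The defining relation of the group, because \<open>g11\<close> inverts
    \<open>r11\<close> and \<open>c r11\<close> is the transpose of \<open>q11\<close>.\<close>
  have g1122: "g11 * transpose_mat q11 = c \<cdot>\<^sub>m 1\<^sub>m r1"
    using mult_smult_distrib[OF g11c bc(7), of c] by (simp add: g11_r11 flip: cr11)
  obtain g where g: "g \<in> G_group l r1 r2" and blocks:
    "mat_block (G_sizes l r1 r2) g 1 1 = g11" "mat_block (G_sizes l r1 r2) g 2 2 = q11"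
    "mat_block (G_sizes l r1 r2) g 2 3 = q12" "mat_block (G_sizes l r1 r2) g 2 4 = g24"
    "mat_block (G_sizes l r1 r2) g 2 5 = g25" "mat_block (G_sizes l r1 r2) g 3 3 = q22"
    "mat_block (G_sizes l r1 r2) g 3 5 = x2" "mat_block (G_sizes l r1 r2) g 4 4 = g44"
    "mat_block (G_sizes l r1 r2) g 4 5 = g45" "mat_block (G_sizes l r1 r2) g 5 5 $$ (0, 0) = c"
    using G_group_from_blocks[OF r1(2) g11c bc(1) bc(2)[unfolded n2_def] g24c g25c q22_GL[unfolded n2_def]
        xc(2)[unfolded n2_def] g44_GL g45c c g1122] by blast
  have "i11 * S * g11 = i11 * (q11 * (S' * r11)) * g11" by (simp add: core)
  also have "i11 * (q11 * (S' * r11)) = S' * r11"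
    using mat_inv_mult_cancel_left[OF q11_GL Sr11] by (simp add: i11_def)
  also have "S' * r11 * g11 = S'"
    using Sc(2) by (simp add: assoc_mult_mat[OF Sc(2) bc(7) g11c] r11_g11)
  finally have eS: "S' = i11 * S * g11" ..
  have a1g24: "row_times a1 g24 = - row_times (row_times b1 (S' * r13)) g44"
    using row_times_mult[OF bc(1) Sr13 a1] row_times_mult[OF p1 g44c a1]
    by (simp add: g24_def row_times_uminus[OF p2 a1] e1)
  have b1Sr: "row_times b1 (S' * r13) \<in> carrier_vec r2" "row_times \<beta>2 r33 \<in> carrier_vec r2"
    by (rule row_c[OF Sr13], rule row_c[OF bc(12)])
  have "row_times \<alpha>2 g44 = row_times (row_times b1 (S' * r13)) g44 + row_times \<beta>2 (r33 * g44)"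
    unfolding e3 row_times_add_vec[OF g44c b1Sr] row_times_mult[OF bc(12) g44c \<beta>2] ..
  hence e4: "\<beta>2 = row_times a1 g24 + row_times \<alpha>2 g44"
    using \<beta>2 row_c[OF g44c, of "row_times b1 (S' * r13)"]
    by (simp add: a1g24 r33_g44) (auto simp: vec_eq_iff)
  \<comment> \<open>This is \<open>core\<close> with \<open>c r11\<close> replaced by the transpose
    of \<open>q11\<close>.\<close>
  have "q11 * S' * transpose_mat q11 = c \<cdot>\<^sub>m S"
    using mult_smult_distrib[OF mult_carrier_mat[OF bc(1) Sc(2)] bc(7), of c] core
    by (simp add: assoc_mult_mat[OF bc(1) Sc(2) bc(7)] flip: cr11)
  hence quad: "quad b1 S' = smult c (quad a1 S) + Delta a1 q11 (strict_upper S')"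
    unfolding e1 by (rule quad_change_of_basis[OF a1 Sc(1) bc(1) S'])
  have uX: "row_times ?u X $ 0 = row_times a1 x1 $ 0 + row_times a2 x2 $ 0"
    using index_row_times_append[OF a1 a2 zero_carrier_vec zero_carrier_vec, of X r2 n4 1 0 1 0] X m
    by (simp add: row_times_blocks_u[OF a1 a2] x1_def x2_def sub_mat_def)
  have wY: "row_times ?w' Y $ 0 = row_times (row_times b1 S') y1 $ 0 + row_times \<beta>2 y3 $ 0"
    using index_row_times_append[OF bS zero_carrier_vec \<beta>2 zero_carrier_vec, of Y n2 n4 1 0 1 0] Y m
    by (simp add: row_times_blocks_w[OF bS \<beta>2] y1_def y3_def sub_mat_def)
  have "row_times (row_times b1 S') y1 = row_times a1 (q11 * (S' * y1))"
    unfolding row_times_mult[OF Sc(2) xc(3) b1] by (simp add: e1 row_times_mult[OF bc(1) p3 a1])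
  moreover have "row_times \<beta>2 y3 = row_times a1 (g24 * y3) + row_times \<alpha>2 (g44 * y3)"
    unfolding e4 row_times_add_vec[OF xc(4) row_c[OF g24c] row_c[OF g44c]]
      row_times_mult[OF g24c xc(4) a1] row_times_mult[OF g44c xc(4) \<alpha>2] ..
  ultimately have wY': "row_times ?w' Y $ 0 =
      row_times a1 (q11 * (S' * y1)) $ 0 + row_times a1 (g24 * y3) $ 0 + row_times \<alpha>2 (g44 * y3) $ 0"
    using wY p6 xc by simp
  have g25_0: "row_times a1 g25 $ 0 = row_times a1 x1 $ 0 - row_times a1 (q11 * (S' * y1)) $ 0
      - row_times a1 (g24 * y3) $ 0"
    unfolding g25_def row_times_minus[OF p7 p5 a1] row_times_minus[OF xc(1) p4 a1]
    using p4 p5 xc by simp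
  have g45_0: "row_times \<alpha>2 g45 $ 0 = - row_times \<alpha>2 (g44 * y3) $ 0"
    unfolding g45_def row_times_uminus[OF p6 \<alpha>2] using p6 xc by simp
  \<comment> \<open>The quadratic parts of the two corners cancel up to
    \<open>Delta\<close>.\<close>
  have "\<beta> = row_times a1 g25 $ 0 + row_times a2 x2 $ 0 + row_times \<alpha>2 g45 $ 0
      + smult c \<alpha> - Delta a1 q11 (strict_upper S')"
    using \<phi> unfolding quad uX wY' g25_0 g45_0 by (simp add: smult_add_right algebra_simps)
  hence "(S', b1, b2, \<beta>2, \<beta>) = star l r1 r2 (S, a1, a2, \<alpha>2, \<alpha>) g"
    using e1 e2 e4 eS by (simp add: Let_def blocks blocks(1)[unfolded One_nat_def] i11_def)
  thus ?thesis using g by blast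
qed

text \<open>The blocks of \<open>g\<close> prescribe the rows of \<open>Q\<close> that act on
  \<open>u\<close>; the remaining rows are dictated by the last columns through \<open>R\<close>.
  Then \<open>X\<close> and \<open>Y\<close> are chosen so that the corner relation becomes the
  formula for \<open>\<beta>\<close>.\<close>

lemma star_imp_equivalent:
  fixes a1 a2 \<alpha>2 b1 b2 \<beta>2 :: "'a::field poly vec"
  assumes r1: "r1 \<le> l" and r2: "l + r2 \<le> m"
    and a1: "a1 \<in> carrier_vec r1" and a2: "a2 \<in> carrier_vec (l - r1)" and \<alpha>2: "\<alpha>2 \<in> carrier_vec r2"
    and b1: "b1 \<in> carrier_vec r1" and b2: "b2 \<in> carrier_vec (l - r1)" and \<beta>2: "\<beta>2 \<in> carrier_vec r2"
    and S: "S \<in> GLss r1" and S': "S' \<in> GLss r1"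
    and ind_b: "lin_indep_entries (b1 @\<^sub>v b2)" and ind_\<beta>: "lin_indep_entries (b1 @\<^sub>v \<beta>2)"
    and g: "g \<in> G_group l r1 r2"
    and star_eq: "(S', b1, b2, \<beta>2, \<beta>) = star l r1 r2 (S, a1, a2, \<alpha>2, \<alpha>) g"
  shows "equivalent_mats (m + 2)
      (bordered_mat m (a1 @\<^sub>v a2 @\<^sub>v 0\<^sub>v r2 @\<^sub>v 0\<^sub>v (m - l - r2))
        (row_times a1 S @\<^sub>v 0\<^sub>v (l - r1) @\<^sub>v \<alpha>2 @\<^sub>v 0\<^sub>v (m - l - r2)) (\<alpha> + quad a1 S))
      (bordered_mat m (b1 @\<^sub>v b2 @\<^sub>v 0\<^sub>v r2 @\<^sub>v 0\<^sub>v (m - l - r2))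
        (row_times b1 S' @\<^sub>v 0\<^sub>v (l - r1) @\<^sub>v \<beta>2 @\<^sub>v 0\<^sub>v (m - l - r2)) (\<beta> + quad b1 S'))"
proof -
  define n2 where "n2 = l - r1"
  define n4 where "n4 = m - l - r2"
  have m: "r1 + n2 + r2 + n4 = m" using r1 r2 by (simp add: n2_def n4_def)
  note a2 = a2[folded n2_def] and b2 = b2[folded n2_def]
  have SGL: "S \<in> GL r1" "S' \<in> GL r1" using S S' by (auto simp: GLss_def)
  note Sc = SGL[THEN GL_carrier]
  have row_c: "row_times x M \<in> carrier_vec k" if "M \<in> carrier_mat n k" for x and M :: "'a mat" and n k
    using that by simp
  define g11 where "g11 = mat_block (G_sizes l r1 r2) g 1 1"
  define g22 where "g22 = mat_block (G_sizes l r1 r2) g 2 2"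
  define g23 where "g23 = mat_block (G_sizes l r1 r2) g 2 3"
  define g24 where "g24 = mat_block (G_sizes l r1 r2) g 2 4"
  define g25 where "g25 = mat_block (G_sizes l r1 r2) g 2 5"
  define g33 where "g33 = mat_block (G_sizes l r1 r2) g 3 3"
  define g35 where "g35 = mat_block (G_sizes l r1 r2) g 3 5"
  define g44 where "g44 = mat_block (G_sizes l r1 r2) g 4 4"
  define g45 where "g45 = mat_block (G_sizes l r1 r2) g 4 5"
  define c where "c = mat_block (G_sizes l r1 r2) g 5 5 $$ (0, 0)"
  note defs = g11_def g22_def g23_def g24_def g25_def g33_def g35_def g44_def g45_def c_def
  have gc: "g11 \<in> carrier_mat r1 r1" "g22 \<in> carrier_mat r1 r1" "g23 \<in> carrier_mat r1 n2"
    "g24 \<in> carrier_mat r1 r2" "g25 \<in> carrier_mat r1 1" "g33 \<in> carrier_mat n2 n2"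
    "g35 \<in> carrier_mat n2 1" "g44 \<in> carrier_mat r2 r2" "g45 \<in> carrier_mat r2 1"
    by (simp_all add: defs mat_block_def G_sizes_def n2_def)
  have c: "c \<noteq> 0" and g1122: "g11 * transpose_mat g22 = c \<cdot>\<^sub>m 1\<^sub>m r1"
    using G_group_diag_blocks[OF r1 g] by (simp_all add: defs)
  have eS: "S' = mat_inv r1 g22 * S * g11" and e1: "b1 = row_times a1 g22"
    and e2: "b2 = row_times a1 g23 + row_times a2 g33"
    and e4: "\<beta>2 = row_times a1 g24 + row_times \<alpha>2 g44"
    and e5: "\<beta> = row_times a1 g25 $ 0 + row_times a2 g35 $ 0 + row_times \<alpha>2 g45 $ 0
      + smult c \<alpha> - Delta a1 g22 (strict_upper S')"
    using star_eq by (simp_all add: Let_def defs)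
  have "g11 * transpose_mat g22 \<in> GL r1"
    unfolding g1122 using c by (intro GL_smult) (auto simp: GL_iff_det)
  hence g11_GL: "g11 \<in> GL r1" and g22_GL: "g22 \<in> GL r1"
    using GL_factors[OF gc(1), of "transpose_mat g22"] gc(2) GL_transpose[of "transpose_mat g22" r1] by auto
  have g33_GL: "g33 \<in> GL n2" by (rule lin_indep_imp_GL[OF ind_b a1 a2 g22_GL gc(3) gc(6) e1 e2])
  have g44_GL: "g44 \<in> GL r2" by (rule lin_indep_imp_GL[OF ind_\<beta> a1 \<alpha>2 g22_GL gc(4) gc(8) e1 e4])
  define r11 where "r11 = mat_inv r1 g11"
  define i44 where "i44 = mat_inv r2 g44"
  have r11c: "r11 \<in> carrier_mat r1 r1" and g11_r11: "g11 * r11 = 1\<^sub>m r1" and r11_g11: "r11 * g11 = 1\<^sub>m r1"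
    using mat_inv_props[OF g11_GL] by (simp_all add: r11_def)
  have i44_GL: "i44 \<in> GL r2" and i44c: "i44 \<in> carrier_mat r2 r2" and g44_i44: "g44 * i44 = 1\<^sub>m r2"
    and i44_g44: "i44 * g44 = 1\<^sub>m r2"
    using mat_inv_GL[OF g44_GL] mat_inv_props[OF g44_GL] by (simp_all add: i44_def)
  have cr11: "c \<cdot>\<^sub>m r11 = transpose_mat g22"
  proof -
    have "transpose_mat g22 = r11 * (g11 * transpose_mat g22)"
      using mat_inv_mult_cancel_left[OF g11_GL, of "transpose_mat g22" r1] gc(2) by (simp add: r11_def)
    also have "\<dots> = c \<cdot>\<^sub>m r11"
      using mult_smult_distrib[OF r11c one_carrier_mat, of c] r11c by (simp add: g1122)
    finally show ?thesis ..
  qed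
  have SG: "S * g11 \<in> carrier_mat r1 r1" by (rule mult_carrier_mat[OF Sc(1) gc(1)])
  \<comment> \<open>The definition of \<open>S'\<close> with the inverse cleared; multiplied by
    \<open>r11\<close> on the right, it matches the first parts of the last columns.\<close>
  have gS': "g22 * S' = S * g11"
    unfolding eS assoc_mult_mat[OF mat_inv_carrier[OF g22_GL] Sc(1) gc(1)]
    by (rule mult_mat_inv_cancel_left[OF g22_GL SG])
  have gS'_GL: "g22 * S' \<in> GL r1" and gS'c: "g22 * S' \<in> carrier_mat r1 r1"
    using GL_mult[OF g22_GL SGL(2)] GL_carrier by auto
  have "g22 * S' * transpose_mat g22 = S * (g11 * transpose_mat g22)"
    using gc(2) by (simp add: gS' assoc_mult_mat[OF Sc(1) gc(1)])
  also have "\<dots> = c \<cdot>\<^sub>m S"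
    using mult_smult_distrib[OF Sc(1) one_carrier_mat, of c] Sc(1) by (simp add: g1122)
  finally have quad: "quad b1 S' = smult c (quad a1 S) + Delta a1 g22 (strict_upper S')"
    unfolding e1 by (rule quad_change_of_basis[OF a1 Sc(1) gc(2) S'])
  have gi: "g24 * i44 \<in> carrier_mat r1 r2" by (rule mult_carrier_mat[OF gc(4) i44c])
  \<comment> \<open>The third part of \<open>w' R = w\<close> requires
    \<open>g22 S' r13 = - g24 g44^-1\<close>; since \<open>g22 S'\<close> is invertible, this
    determines \<open>r13 = - t\<close>.\<close>
  define t where "t = mat_inv r1 (g22 * S') * (g24 * i44)"
  have tc: "t \<in> carrier_mat r1 r2"
    unfolding t_def by (rule mult_carrier_mat[OF mat_inv_carrier[OF gS'_GL] gi])
  define r13 where "r13 = - t"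
  have r13c: "r13 \<in> carrier_mat r1 r2" using tc by (simp add: r13_def)
  have gt: "g22 * S' * t = g24 * i44"
    unfolding t_def by (rule mult_mat_inv_cancel_left[OF gS'_GL gi])
  \<comment> \<open>Chosen so that \<open>- \<beta>2 y3\<close> contains
    \<open>\<alpha>2 g45\<close>. It also produces a multiple of \<open>a1\<close>, which the
    correction in \<open>x1\<close> removes.\<close>
  define y3 where "y3 = - (i44 * g45)"
  have ig: "i44 * g45 \<in> carrier_mat r2 1" by (rule mult_carrier_mat[OF i44c gc(9)])
  have y3c: "y3 \<in> carrier_mat r2 1" using ig by (simp add: y3_def)
  have gig: "g24 * (i44 * g45) \<in> carrier_mat r1 1" by (rule mult_carrier_mat[OF gc(4) ig])
  define x1 where "x1 = g25 - g24 * (i44 * g45)"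
  have x1c: "x1 \<in> carrier_mat r1 1" unfolding x1_def by (rule minus_carrier_mat[OF gig])
  let ?ns = "[r1, n2, r2, n4]"
  \<comment> \<open>The blocks in the third row are those wanted in \<open>R\<close>, carried over
    by \<open>c R = Q^T\<close>. The last \<open>n4\<close> coordinates, where \<open>u\<close> and
    \<open>w\<close> vanish, are left fixed by the identity.\<close>
  define F where "F i j = (if (i, j) = (1, 1) then g22 else if (i, j) = (1, 2) then g23
    else if (i, j) = (2, 2) then g33 else if (i, j) = (3, 1) then transpose_mat (c \<cdot>\<^sub>m r13)
    else if (i, j) = (3, 3) then transpose_mat (c \<cdot>\<^sub>m i44) else if (i, j) = (4, 4) then 1\<^sub>m n4
    else 0\<^sub>m (?ns ! (i - 1)) (?ns ! (j - 1)))" for i j :: nat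
  define Q where "Q = assemble ?ns F"
  define R where "R = inverse c \<cdot>\<^sub>m transpose_mat Q"
  have "sum_list ?ns = m" using m by simp
  have Qm: "Q \<in> carrier_mat m m"
    using assemble_carrier[of ?ns F] m by (simp add: Q_def add.assoc)
  hence Rm: "R \<in> carrier_mat m m" by (simp add: R_def)
  have cR: "c \<cdot>\<^sub>m R = transpose_mat Q" using c Qm by (auto simp: R_def intro!: eq_matI)
  have Fc: "F i j \<in> carrier_mat (?ns ! (i - 1)) (?ns ! (j - 1))" for i j
    using gc r13c i44c by (simp add: F_def)
  have blk: "mat_block ?ns Q i j = F i j" if "i \<in> {1..4}" "j \<in> {1..4}" for i j
    unfolding Q_def using that by (intro mat_block_assemble Fc) auto
  have sub: "sub_mat 0 r1 0 r1 Q = g22" "sub_mat 0 r1 r1 n2 Q = g23" "sub_mat 0 r1 (r1 + n2) r2 Q = 0\<^sub>m r1 r2"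
    "sub_mat 0 r1 (r1 + n2 + r2) n4 Q = 0\<^sub>m r1 n4"
    "sub_mat r1 n2 0 r1 Q = 0\<^sub>m n2 r1" "sub_mat r1 n2 r1 n2 Q = g33" "sub_mat r1 n2 (r1 + n2) r2 Q = 0\<^sub>m n2 r2"
    "sub_mat r1 n2 (r1 + n2 + r2) n4 Q = 0\<^sub>m n2 n4"
    "sub_mat (r1 + n2) r2 0 r1 Q = transpose_mat (c \<cdot>\<^sub>m r13)" "sub_mat (r1 + n2) r2 (r1 + n2) r2 Q = transpose_mat (c \<cdot>\<^sub>m i44)"
    "sub_mat (r1 + n2 + r2) n4 0 r1 Q = 0\<^sub>m n4 r1" "sub_mat (r1 + n2 + r2) n4 (r1 + n2) r2 Q = 0\<^sub>m n4 r2"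
    using blk[of 1 1] blk[of 1 2] blk[of 1 3] blk[of 1 4] blk[of 2 1] blk[of 2 2] blk[of 2 3] blk[of 2 4]
      blk[of 3 1] blk[of 3 3] blk[of 4 1] blk[of 4 3]
    by (simp_all add: mat_block_def sub_mat_def F_def numeral_eq_Suc add.assoc)
  have GL1: "1\<^sub>m n4 \<in> GL n4" by (simp add: GL_iff_det)
  have QGL: "Q \<in> GL m"
  proof -
    \<comment> \<open>The off-diagonal blocks that may be nonzero are (1, 2) and (3, 1), so the
      parts 2 and 4 are solved first, then 1, then 3.\<close>
    have "Q \<in> GL (sum_list ?ns)"
    proof (rule block_triangular_imp_GL[where rank = "\<lambda>b. if b = 1 then 1 else if b = 3 then 2 else 0"])
      show "Q \<in> carrier_mat (sum_list ?ns) (sum_list ?ns)" by (simp only: Q_def assemble_carrier)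
      fix b assume b: "b \<in> {1..length ?ns}"
      hence b4: "b = 1 \<or> b = 2 \<or> b = 3 \<or> b = 4" by auto
      show "mat_block ?ns Q b b \<in> GL (?ns ! (b - 1))"
        using b4 g22_GL g33_GL GL_transpose[OF GL_smult[OF i44_GL c]] GL1
        by (elim disjE) (simp_all add: blk, simp_all add: F_def)
      fix d assume d: "d \<in> {1..length ?ns}" and "b \<noteq> d"
        and "(if b = 1 then 1 else if b = 3 then 2 else 0) \<le> (if d = 1 then 1 else if d = 3 then 2 else 0 :: nat)"
      hence "(b, d) \<notin> {(1, 1), (1, 2), (2, 2), (3, 1), (3, 3), (4, 4)}" by auto
      thus "mat_block ?ns Q b d = 0\<^sub>m (?ns ! (b - 1)) (?ns ! (d - 1))"
        using b d by (auto simp: blk F_def)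
    qed
    thus ?thesis using \<open>sum_list ?ns = m\<close> by metis
  qed
  have subR: "sub_mat s d t e R = inverse c \<cdot>\<^sub>m transpose_mat (sub_mat t e s d Q)"
    if "s + d \<le> m" "t + e \<le> m" for s d t e
    unfolding R_def using that Qm
    by (subst sub_mat_smult[where n = m and k = m]) (auto simp: sub_mat_transpose[OF Qm])
  have scale: "inverse c \<cdot>\<^sub>m (c \<cdot>\<^sub>m M) = M" for M :: "'a mat"
    using c by (intro eq_matI) auto
  have R_blocks: "sub_mat 0 r1 0 r1 R = r11" "sub_mat 0 r1 r1 n2 R = 0\<^sub>m r1 n2"
    "sub_mat 0 r1 (r1 + n2) r2 R = r13" "sub_mat 0 r1 (r1 + n2 + r2) n4 R = 0\<^sub>m r1 n4"
    "sub_mat (r1 + n2) r2 0 r1 R = 0\<^sub>m r2 r1" "sub_mat (r1 + n2) r2 r1 n2 R = 0\<^sub>m r2 n2"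
    "sub_mat (r1 + n2) r2 (r1 + n2) r2 R = i44" "sub_mat (r1 + n2) r2 (r1 + n2 + r2) n4 R = 0\<^sub>m r2 n4"
    using m by (simp_all add: subR sub scale flip: cr11)
  have aS: "row_times a1 S \<in> carrier_vec r1" and bS: "row_times b1 S' \<in> carrier_vec r1"
    using Sc by auto
  let ?u = "a1 @\<^sub>v a2 @\<^sub>v 0\<^sub>v r2 @\<^sub>v 0\<^sub>v n4" and ?u' = "b1 @\<^sub>v b2 @\<^sub>v 0\<^sub>v r2 @\<^sub>v 0\<^sub>v n4"
  let ?w = "row_times a1 S @\<^sub>v 0\<^sub>v n2 @\<^sub>v \<alpha>2 @\<^sub>v 0\<^sub>v n4" and ?w' = "row_times b1 S' @\<^sub>v 0\<^sub>v n2 @\<^sub>v \<beta>2 @\<^sub>v 0\<^sub>v n4"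
  have carr: "?u \<in> carrier_vec m" "?w \<in> carrier_vec m" "?u' \<in> carrier_vec m" "?w' \<in> carrier_vec m"
    using a1 a2 b1 b2 \<alpha>2 \<beta>2 carrier_matD(2)[OF Sc(1)] carrier_matD(2)[OF Sc(2)] m
    by (auto intro!: carrier_vecI)
  have uQ: "row_times ?u Q = ?u'"
    using a1 a2 b1 b2 e1 e2
    unfolding row_times_append[OF a1 a2 zero_carrier_vec zero_carrier_vec Qm[folded m]]
      row_times_blocks_u[OF a1 a2] sub by simp
  have b1S'M: "row_times (row_times b1 S') M = row_times a1 (g22 * S' * M)"
    if M: "M \<in> carrier_mat r1 k" for M k
    using row_times_mult[OF gc(2) Sc(2) a1] row_times_mult[OF gS'c M a1] by (simp add: e1)
  have w1: "row_times (row_times b1 S') r11 = row_times a1 S"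
    using Sc(1) by (simp add: b1S'M[OF r11c] gS' assoc_mult_mat[OF Sc(1) gc(1) r11c] g11_r11)
  have "g22 * S' * r13 = - (g24 * i44)"
    unfolding r13_def gt[symmetric] by (rule uminus_mult_right_mat) (use Sc(2) tc in simp)
  hence "row_times (row_times b1 S') r13 = - row_times a1 (g24 * i44)"
    by (simp add: b1S'M[OF r13c] row_times_uminus[OF gi a1])
  moreover have "row_times \<beta>2 i44 = row_times a1 (g24 * i44) + \<alpha>2"
    unfolding e4 row_times_add_vec[OF i44c row_c[OF gc(4)] row_c[OF gc(8)]]
    using \<alpha>2 by (simp add: row_times_mult[OF gc(4) i44c a1] row_times_mult[OF gc(8) i44c \<alpha>2] g44_i44)
  ultimately have w3: "row_times (row_times b1 S') r13 + row_times \<beta>2 i44 = \<alpha>2"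
    using row_c[OF gi, of a1] \<alpha>2 by (auto simp: vec_eq_iff)
  have wR: "row_times ?w' R = ?w"
    unfolding row_times_append[OF bS zero_carrier_vec \<beta>2 zero_carrier_vec Rm[folded m]]
      row_times_blocks_w[OF bS \<beta>2] R_blocks w1 w3 using bS aS \<beta>2 by simp
  \<comment> \<open>Blocks of \<open>X\<close> below the second meet the zeros of \<open>u\<close>,
    and the second and fourth blocks of \<open>Y\<close> those of \<open>w'\<close>. The first block
    of \<open>Y\<close> is taken to be zero, all of the \<open>a1\<close>-term being put into
    \<open>x1\<close>.\<close>
  define X where "X = mat m 1 (\<lambda>(i, _). if i < r1 then x1 $$ (i, 0) else if i < l then g35 $$ (i - r1, 0) else 0)"
  define Y where "Y = mat m 1 (\<lambda>(i, _). if r1 + n2 \<le> i \<and> i < r1 + n2 + r2 then y3 $$ (i - (r1 + n2), 0) else 0)"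
  have Xc: "X \<in> carrier_mat m 1" and Yc: "Y \<in> carrier_mat m 1" by (simp_all add: X_def Y_def)
  have X_blocks: "sub_mat 0 r1 0 1 X = x1" "sub_mat r1 n2 0 1 X = g35"
    using m r1 x1c gc(7) by (auto simp: sub_mat_def X_def n2_def intro!: eq_matI)
  have Y_blocks: "sub_mat 0 r1 0 1 Y = 0\<^sub>m r1 1" "sub_mat (r1 + n2) r2 0 1 Y = y3"
    using m y3c by (auto simp: sub_mat_def Y_def intro!: eq_matI)
  have uX: "row_times ?u X $ 0 = row_times a1 x1 $ 0 + row_times a2 g35 $ 0"
    using index_row_times_append[OF a1 a2 zero_carrier_vec zero_carrier_vec, of X r2 n4 1 0 1 0] Xc m gc(7)
    by (simp add: row_times_blocks_u[OF a1 a2] X_blocks[simplified])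
  have wY: "row_times ?w' Y $ 0 = row_times \<beta>2 y3 $ 0"
    using index_row_times_append[OF bS zero_carrier_vec \<beta>2 zero_carrier_vec, of Y n2 n4 1 0 1 0] Yc m y3c bS
    by (simp add: row_times_blocks_w[OF bS \<beta>2] Y_blocks[simplified])
  have gg: "g44 * (i44 * g45) = g45"
    using mult_mat_inv_cancel_left[OF g44_GL gc(9)] by (simp add: i44_def)
  have "row_times \<beta>2 (i44 * g45) = row_times a1 (g24 * (i44 * g45)) + row_times \<alpha>2 g45"
    unfolding e4 row_times_add_vec[OF ig row_c[OF gc(4)] row_c[OF gc(8)]]
      row_times_mult[OF gc(4) ig a1] row_times_mult[OF gc(8) ig \<alpha>2] gg ..
  hence y3_0: "row_times \<beta>2 y3 $ 0 = - row_times a1 (g24 * (i44 * g45)) $ 0 - row_times \<alpha>2 g45 $ 0"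
    unfolding y3_def row_times_uminus[OF ig \<beta>2] using gc(9) gig by simp
  have x1_0: "row_times a1 x1 $ 0 = row_times a1 g25 $ 0 - row_times a1 (g24 * (i44 * g45)) $ 0"
    unfolding x1_def row_times_minus[OF gc(5) gig a1] using gc(5,9) by simp
  have \<phi>: "\<beta> + quad b1 S' = smult c (\<alpha> + quad a1 S) + row_times ?u X $ 0 - row_times ?w' Y $ 0"
    unfolding quad uX wY y3_0 x1_0 by (simp add: e5 smult_add_right algebra_simps)
  show ?thesis
    using equivalent_bordered_matI[OF carr c QGL Rm Xc Yc cR uQ wR \<phi>] by (simp add: n2_def n4_def)
qed

section \<open>Application to the parametrized exponential matrices\<close>

lemma hslash_eq_bordered_mat:
  assumes "(S, a1, a2, \<alpha>2, \<alpha>) \<in> frakX l r1 r2" and "r1 \<le> l" "l + r2 \<le> m"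
  shows "hslash m l r1 r2 (S, a1, a2, \<alpha>2, \<alpha>) = bordered_mat m
    (a1 @\<^sub>v a2 @\<^sub>v 0\<^sub>v r2 @\<^sub>v 0\<^sub>v (m - l - r2))
    (row_times a1 S @\<^sub>v 0\<^sub>v (l - r1) @\<^sub>v \<alpha>2 @\<^sub>v 0\<^sub>v (m - l - r2)) (\<alpha> + quad a1 S)"
proof -
  have c: "S \<in> carrier_mat r1 r1" "a1 \<in> carrier_vec r1" "a2 \<in> carrier_vec (l - r1)" "\<alpha>2 \<in> carrier_vec r2"
    using assms(1) GL_carrier by (auto simp: frakX_def GLss_def p_poly_vecs_def)
  have "hslash m l r1 r2 (S, a1, a2, \<alpha>2, \<alpha>) = h_mat m l r1 r2 a1 a2 (row_times a1 S) \<alpha>2 (\<alpha> + quad a1 S)"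
    using c by (simp add: quad_def)
  thus ?thesis
    using h_mat_eq_bordered_mat[OF c(2,3) row_times_carrier[OF c(1)] c(4) assms(2,3)] by simp
qed

theorem theorem3p17:
  fixes m l r1 r2 :: nat
    and A B :: "'a::field poly mat"
    and S S' :: "'a mat"
    and a1 a2 \<alpha>2 b1 b2 \<beta>2 :: "'a poly vec"
    and \<alpha> \<beta> :: "'a poly"
  assumes "CHAR('a) > 0"
    and "m \<ge> 1"
    and "(l, r1, r2) \<in> Omega m"
    and "A \<in> exponential_part (m + 2) (frakH m l r1 r2)"
    and "B \<in> exponential_part (m + 2) (frakH m l r1 r2)"
    and "(S, a1, a2, \<alpha>2, \<alpha>) \<in> frakX l r1 r2"
    and "A = hslash m l r1 r2 (S, a1, a2, \<alpha>2, \<alpha>)"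
    and "(S', b1, b2, \<beta>2, \<beta>) \<in> frakX l r1 r2"
    and "B = hslash m l r1 r2 (S', b1, b2, \<beta>2, \<beta>)"
  shows "equivalent_mats (m + 2) A B \<longleftrightarrow>
    (\<exists>g\<in>G_group l r1 r2. (S', b1, b2, \<beta>2, \<beta>) = star l r1 r2 (S, a1, a2, \<alpha>2, \<alpha>) g)"
proof -
  have r: "1 \<le> r1" "r1 \<le> l" "l + r2 \<le> m" using assms(3) by (auto simp: Omega_def)
  have A: "a1 \<in> carrier_vec r1" "a2 \<in> carrier_vec (l - r1)" "\<alpha>2 \<in> carrier_vec r2" "S \<in> GLss r1"
    "lin_indep_entries (a1 @\<^sub>v a2)" "lin_indep_entries (a1 @\<^sub>v \<alpha>2)"
    using assms(6) by (auto simp: frakX_def p_poly_vecs_def)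
  have B: "b1 \<in> carrier_vec r1" "b2 \<in> carrier_vec (l - r1)" "\<beta>2 \<in> carrier_vec r2" "S' \<in> GLss r1"
    "lin_indep_entries (b1 @\<^sub>v b2)" "lin_indep_entries (b1 @\<^sub>v \<beta>2)"
    using assms(8) by (auto simp: frakX_def p_poly_vecs_def)
  show ?thesis
    unfolding assms(7,9) hslash_eq_bordered_mat[OF assms(6) r(2,3)] hslash_eq_bordered_mat[OF assms(8) r(2,3)]
    using equivalent_imp_star[OF r A(1-3) B(1-3) A(4) B(4) A(5,6) B(5,6)]
      star_imp_equivalent[OF r(2,3) A(1-3) B(1-3) A(4) B(4) B(5,6)] by blast
qed

end
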